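(* Let $f$ be a Hecke-holomorphic or Hecke-Maass cusp form for $\mathrm{SL}(2,\mathbb{Z})$ with normalized Fourier coefficients $\mathcal{A}_f(n)$, and let $\ell>4$ be an integer. For every (arbitrarily small) $\varepsilon>0$ there is a constant $C=C(f,\ell,\varepsilon)>0$ such that for all real $X,Y\geqslant 1$ with $Y<X^{1-\varepsilon}$, $$\left|\sum_{1\leqslant n\leqslant X}\ \sum_{1\leqslant m\leqslant Y}r_\ell(n)\,\mathcal{A}_f(n+m)\right|\leqslant C\,\frac{X^{3/8}}{Y^{3/4}}\,\left(X^{\ell/2}Y\right)^{1+\varepsilon}.$$ This bound is non-trivial in the range $X^{1/2}<Y<X^{1-\varepsilon}$, i.e. there the factor $X^{3/8}/Y^{3/4}$ is less than $1$.
   Context: Fourier coefficients: write $e(x)=e^{2\pi i x}$. If $f$ is a primitive holomorphic Hecke eigen-cusp form of integral weight $\kappa$ for $\mathrm{SL}(2,\mathbb{Z})$, the $\mathcal{A}_f(n)$ are defined by $f(z)=\sum_{n\geqslant 1}\mathcal{A}_f(n)n^{(\kappa-1)/2}e(nz)$ with $\mathcal{A}_f(1)=1$. If $f$ is a primitive Hecke-Maass cusp form for $\mathrm{SL}(2,\mathbb{Z})$ with Laplace eigenvalue $\tfrac14+\nu^2$, they are defined by $f(x+iy)=2\sqrt{y}\sum_{n\neq 0}\mathcal{A}_f(n)K_{i\nu}(2\pi|n|y)e(nx)$ with $\mathcal{A}_f(1)=1$, where $K_{i\nu}$ is the $K$-Bessel function. For $\ell\in\mathbb{N}$, $r_\ell(n)=|\{(n_1,\dots,n_\ell)\in\mathbb{Z}^\ell: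 n_1^2+\cdots+n_\ell^2=n\}|$. *)

theory Defs
  imports "HOL-Analysis.Analysis"
begin

definition upper_half_plane :: "complex set" where
  "upper_half_plane = {z. Im z > 0}"

definition e2pi :: "complex \<Rightarrow> complex" where
  "e2pi z = exp (2 * of_real pi * \<i> * z)"

text \<open>Invariance of weight \<open>\<kappa>\<close> under all of \<open>SL(2,\<int>)\<close>; weight 0 is plain invariance.\<close>

definition modular_invariant :: "int \<Rightarrow> (complex \<Rightarrow> complex) \<Rightarrow> bool" where
  "modular_invariant \<kappa> f \<longleftrightarrow>
     (\<forall>a b c d :: int. a * d - b * c = 1 \<longrightarrow>
       (\<forall>z\<in>upper_half_plane.
          f ((of_int a * z + of_int b) / (of_int c * z + of_int d)) =
            (of_int c * z + of_int d) powi \<kappa> * f z))"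


subsection \<open>Holomorphic forms\<close>

definition holomorphic_cusp_form :: "int \<Rightarrow> (complex \<Rightarrow> complex) \<Rightarrow> bool" where
  "holomorphic_cusp_form \<kappa> f \<longleftrightarrow>
     f holomorphic_on upper_half_plane \<and>
     modular_invariant \<kappa> f \<and>
     (f \<longlongrightarrow> 0) (filtercomap Im at_top)"

text \<open>\<open>T\<^sub>n f(z) = n\<^sup>\<kappa>\<^sup>-\<^sup>1 \<Sum>\<^bsub>ad = n\<^esub> d\<^sup>-\<^sup>\<kappa> \<Sum>\<^bsub>0 \<le> b < d\<^esub> f((az + b)/d)\<close>\<close>

definition hecke_op_holomorphic ::
    "int \<Rightarrow> nat \<Rightarrow> (complex \<Rightarrow> complex) \<Rightarrow> complex \<Rightarrow> complex" where
  "hecke_op_holomorphic \<kappa> n f z =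
     of_nat n powi (\<kappa> - 1) *
       (\<Sum>d | d dvd n. of_nat d powi (- \<kappa>) *
          (\<Sum>b<d. f ((of_nat (n div d) * z + of_nat b) / of_nat d)))"

definition hecke_holomorphic_cusp_form :: "int \<Rightarrow> (complex \<Rightarrow> complex) \<Rightarrow> bool" where
  "hecke_holomorphic_cusp_form \<kappa> f \<longleftrightarrow>
     holomorphic_cusp_form \<kappa> f \<and>
     (\<forall>n\<ge>1. \<exists>\<mu>. \<forall>z\<in>upper_half_plane. hecke_op_holomorphic \<kappa> n f z = \<mu> * f z)"

text \<open>The coefficients are indexed by \<^typ>\<open>int\<close> to share a type with those of Maass forms;
  here only the values at positive integers are constrained.\<close>

definition holomorphic_fourier_coeffs ::
    "int \<Rightarrow> (complex \<Rightarrow> complex) \<Rightarrow> (int \<Rightarrow> complex) \<Rightarrow> bool" where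
  "holomorphic_fourier_coeffs \<kappa> f A \<longleftrightarrow>
     (\<forall>z\<in>upper_half_plane.
        ((\<lambda>n. A n * of_real (of_int n powr ((of_int \<kappa> - 1) / 2)) * e2pi (of_int n * z))
           has_sum f z) {1..})"


subsection \<open>Maass forms\<close>

definition d_dx :: "(complex \<Rightarrow> complex) \<Rightarrow> complex \<Rightarrow> complex" where
  "d_dx f z = vector_derivative (\<lambda>t. f (z + of_real t)) (at 0)"

definition d_dy :: "(complex \<Rightarrow> complex) \<Rightarrow> complex \<Rightarrow> complex" where
  "d_dy f z = vector_derivative (\<lambda>t. f (z + \<i> * of_real t)) (at 0)"

text \<open>\<open>C\<^sup>k\<close> in the real sense.\<close>

primrec Ck_on_uhp :: "nat \<Rightarrow> (complex \<Rightarrow> complex) \<Rightarrow> bool" where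
  "Ck_on_uhp 0 f = continuous_on upper_half_plane f"
| "Ck_on_uhp (Suc k) f =
     ((\<forall>z\<in>upper_half_plane.
         (\<lambda>t::real. f (z + of_real t)) differentiable (at 0) \<and>
         (\<lambda>t::real. f (z + \<i> * of_real t)) differentiable (at 0)) \<and>
      continuous_on upper_half_plane f \<and> Ck_on_uhp k (d_dx f) \<and> Ck_on_uhp k (d_dy f))"

definition hyperbolic_laplacian :: "(complex \<Rightarrow> complex) \<Rightarrow> complex \<Rightarrow> complex" where
  "hyperbolic_laplacian f z =
     - of_real ((Im z)\<^sup>2) * (d_dx (d_dx f) z + d_dy (d_dy f) z)"

definition SL2Z_fundamental_domain :: "complex set" where
  "SL2Z_fundamental_domain = {z \<in> upper_half_plane. \<bar>Re z\<bar> \<le> 1 / 2 \<and> norm z \<ge> 1}"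

text \<open>The spectral parameter \<open>\<nu>\<close> is allowed to be complex, so no assumption on the size of the
  eigenvalue \<open>1/4 + \<nu>\<^sup>2\<close> is built in. The weight \<open>1 / (Im z)\<^sup>2\<close> is the hyperbolic measure.\<close>

definition maass_cusp_form :: "complex \<Rightarrow> (complex \<Rightarrow> complex) \<Rightarrow> bool" where
  "maass_cusp_form \<nu> f \<longleftrightarrow>
     (\<forall>k. Ck_on_uhp k f) \<and>
     modular_invariant 0 f \<and>
     (\<forall>z\<in>upper_half_plane. hyperbolic_laplacian f z = (1 / 4 + \<nu>\<^sup>2) * f z) \<and>
     set_integrable lborel SL2Z_fundamental_domain (\<lambda>z. (norm (f z))\<^sup>2 / (Im z)\<^sup>2) \<and>
     (\<forall>y>0. integral {0..1} (\<lambda>x. f (Complex x y)) = 0)"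

text \<open>\<open>T\<^sub>n f(z) = n\<^sup>-\<^sup>1\<^sup>/\<^sup>2 \<Sum>\<^bsub>ad = n\<^esub> \<Sum>\<^bsub>0 \<le> b < d\<^esub> f((az + b)/d)\<close>\<close>

definition hecke_op_maass :: "nat \<Rightarrow> (complex \<Rightarrow> complex) \<Rightarrow> complex \<Rightarrow> complex" where
  "hecke_op_maass n f z =
     of_real (1 / sqrt (real n)) *
       (\<Sum>d | d dvd n. \<Sum>b<d. f ((of_nat (n div d) * z + of_nat b) / of_nat d))"

definition hecke_maass_cusp_form :: "complex \<Rightarrow> (complex \<Rightarrow> complex) \<Rightarrow> bool" where
  "hecke_maass_cusp_form \<nu> f \<longleftrightarrow>
     maass_cusp_form \<nu> f \<and>
     (\<forall>n\<ge>1. \<exists>\<mu>. \<forall>z\<in>upper_half_plane. hecke_op_maass n f z = \<mu> * f z)"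

text \<open>\<open>K\<^sub>s(y) = \<integral>\<^sub>0\<^sup>\<infinity> exp(-y cosh t) cosh(s t) dt\<close> for \<open>y > 0\<close>.\<close>

definition bessel_K :: "complex \<Rightarrow> real \<Rightarrow> complex" where
  "bessel_K s y = (LBINT t:{0..}. of_real (exp (- y * cosh t)) * cosh (s * of_real t))"

definition maass_fourier_coeffs ::
    "complex \<Rightarrow> (complex \<Rightarrow> complex) \<Rightarrow> (int \<Rightarrow> complex) \<Rightarrow> bool" where
  "maass_fourier_coeffs \<nu> f A \<longleftrightarrow>
     (\<forall>x y. y > 0 \<longrightarrow>
        ((\<lambda>n. 2 * of_real (sqrt y) * A n * bessel_K (\<i> * \<nu>) (2 * pi * \<bar>of_int n\<bar> * y) *
                e2pi (of_int n * of_real x))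
           has_sum f (Complex x y)) (- {0}))"


subsection \<open>Sums of squares\<close>

definition r_squares :: "nat \<Rightarrow> nat \<Rightarrow> nat" where
  "r_squares l n = card {v :: int list. length v = l \<and> (\<Sum>k\<leftarrow>v. k\<^sup>2) = int n}"

end

theory Submission
  imports Defs
begin

text \<open>
  Write \<open>L\<close> for logarithmic factors and \<open>S(x)\<close> for the sum of \<open>A(n)\<close> over \<open>n \<le> x\<close>. The double sum
  is the sum of \<open>r\<^sub>l(n) (S(n + Y) - S(n))\<close> over \<open>n \<le> X\<close>, and it satisfies two bounds:

  \<^item> it is at most a constant times \<open>X\<^bsup>l/2\<^esup> Y L\<close>. This needs no cancellation, only Cauchy-Schwarz
    and the second moments of \<open>A(n)\<close> (\<open>whittaker_expansion.mean_square\<close>) and of \<open>r\<^sub>l(n)\<close>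
    (\<open>sum_r_squares_power2_le\<close>);

  \<^item> it is at most a constant times \<open>X\<^bsup>l/2\<^esup> sqrt X L\<close>. This follows from Hecke's bound
    \<open>S(x) = O(sqrt x L)\<close> (\<open>whittaker_expansion.partial_sum\<close>) and the number of lattice points in a
    ball (\<open>sum_r_squares_le\<close>).

  So the double sum is at most a constant times \<open>X\<^bsup>l/2\<^esup> min(Y, sqrt X) L\<close>. A minimum is at most any
  weighted geometric mean, and \<open>(sqrt X)\<^bsup>3/4\<^esup> Y\<^bsup>1/4\<^esup> = X\<^bsup>3/8\<^esup> Y\<^bsup>-3/4\<^esup> Y\<close> is the factor in the claim,
  while the exponent \<open>1 + \<epsilon>\<close> absorbs \<open>L\<close>.

  The two facts on \<open>A(n)\<close> come from the boundedness of an automorphic function \<open>h\<close> on the upper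
  half-plane: \<open>h(z) = (Im z)\<^bsup>\<kappa>/2\<^esup> f(z)\<close> for a holomorphic form and \<open>h = f\<close> for a Maass form. Along the
  line \<open>Im z = y\<close> the function \<open>h\<close> is a Fourier series with coefficients \<open>sqrt y A(n) W(2 \<pi> |n| y)\<close>.
  Bessel's inequality and integration against a Dirichlet kernel bound these coefficients in mean
  square and in partial sums. With \<open>y\<close> of order \<open>1 / N\<close> the weight \<open>W\<close> is of constant size for
  the \<open>n\<close> between \<open>N / 2\<close> and \<open>N\<close>, and can be removed. The properties of \<open>W\<close> that this requires are
  collected in a locale; for Maass forms they are estimates of the \<open>K\<close>-Bessel function.

  The second moment of \<open>r\<^sub>l(n)\<close> counts pairs of integer points of equal norm. Differences of squares
  factor, which turns the count into one of the solutions of \<open>p q = r s\<close> in an interval.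
\<close>

section \<open>Trigonometric polynomials\<close>

abbreviation fourier_char :: "int \<Rightarrow> real \<Rightarrow> complex" where
  "fourier_char n x \<equiv> cis (2 * pi * of_int n * x)"

lemma fourier_char_has_integral:
  "(fourier_char n has_integral (if n = 0 then 1 else 0)) {0..1}"
proof (cases "n = 0")
  case True
  thus ?thesis using has_integral_const_real[of "1::complex" 0 1] by simp
next
  case False
  define c where "c = 2 * pi * of_int n"
  have c: "c \<noteq> 0" using False by (simp add: c_def)
  have "((\<lambda>x. cis (c * x)) has_integral (cis (c * 1) / (\<i> * c) - cis (c * 0) / (\<i> * c))) {0..1}"
  proof (rule fundamental_theorem_of_calculus)
    fix x :: real
    show "((\<lambda>x. cis (c * x) / (\<i> * c)) has_vector_derivative cis (c * x)) (at x within {0..1})"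
      using c unfolding cis_conv_exp of_real_mult
      by (intro has_vector_derivative_real_field) (auto intro!: derivative_eq_intros simp: mult_ac)
  qed simp
  moreover have "cis (c * 1) = 1" using cis_multiple_2pi[of "of_int n"] by (simp add: c_def mult_ac)
  ultimately show ?thesis using False by (simp add: c_def)
qed

lemma trig_poly_product_has_integral:
  assumes "finite J" "finite S" "S \<subseteq> J"
  shows "((\<lambda>x. (\<Sum>n\<in>J. c n * fourier_char n x) * (\<Sum>n\<in>S. b n * fourier_char (-n) x))
           has_integral (\<Sum>n\<in>S. c n * b n)) {0..1}"
proof -
  have "((\<lambda>x. \<Sum>n\<in>J. \<Sum>m\<in>S. c n * b m * fourier_char (n - m) x) has_integral
          (\<Sum>n\<in>J. \<Sum>m\<in>S. c n * b m * (if n - m = 0 then 1 else 0))) {0..1}"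
    by (intro has_integral_sum has_integral_mult_right fourier_char_has_integral assms)
  also have "(\<Sum>n\<in>J. \<Sum>m\<in>S. c n * b m * (if n - m = 0 then 1 else 0))
       = (\<Sum>m\<in>S. \<Sum>n\<in>J. if n = m then c n * b m else 0)"
    by (subst sum.swap) (intro sum.cong refl, auto)
  also have "\<dots> = (\<Sum>m\<in>S. c m * b m)"
    using assms by (intro sum.cong refl) (auto simp: sum.delta)
  also have "(\<lambda>x. \<Sum>n\<in>J. \<Sum>m\<in>S. c n * b m * fourier_char (n - m) x)
      = (\<lambda>x. (\<Sum>n\<in>J. c n * fourier_char n x) * (\<Sum>n\<in>S. b n * fourier_char (-n) x))"
    by (simp add: sum_product fun_eq_iff cis_mult ring_distribs mult.assoc mult.left_commute)
  finally show ?thesis .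
qed

text \<open>Bessel's inequality in a form that involves only finite trigonometric polynomials: an infinite
  Fourier expansion will be truncated before it is integrated.\<close>

lemma trig_poly_coeff_sum_squares_le:
  assumes "finite J" and bound: "\<And>x. norm (\<Sum>n\<in>J. c n * fourier_char n x) \<le> B"
  shows "(\<Sum>n\<in>J. (norm (c n))\<^sup>2) \<le> B\<^sup>2"
proof -
  let ?F = "\<lambda>x. \<Sum>n\<in>J. c n * fourier_char n x"
  have eq: "(\<Sum>n\<in>J. cnj (c n) * fourier_char (-n) x) = cnj (?F x)" for x
    by (simp add: cis_cnj)
  have "((\<lambda>x. ?F x * cnj (?F x)) has_integral (\<Sum>n\<in>J. c n * cnj (c n))) {0..1}"
    using trig_poly_product_has_integral[of J J c "\<lambda>n. cnj (c n)"] assms(1) unfolding eq by simp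
  hence "norm (\<Sum>n\<in>J. c n * cnj (c n)) \<le> B\<^sup>2 * measure lborel (cbox 0 (1::real))"
  proof (intro has_integral_bound)
    fix x
    have "norm (?F x) * norm (?F x) \<le> B * B"
      by (intro mult_mono bound) (auto intro: order.trans[OF norm_ge_zero bound])
    thus "norm (?F x * cnj (?F x)) \<le> B\<^sup>2"
      by (simp add: norm_mult power2_eq_square del: cnj_sum)
  qed (auto simp: cbox_interval)
  moreover have "(\<Sum>n\<in>J. c n * cnj (c n)) = of_real (\<Sum>n\<in>J. (norm (c n))\<^sup>2)"
    by (simp only: complex_norm_square of_real_sum)
  moreover have "\<bar>\<Sum>n\<in>J. (norm (c n))\<^sup>2\<bar> = (\<Sum>n\<in>J. (norm (c n))\<^sup>2)"
    by (simp add: sum_nonneg)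
  ultimately show ?thesis by (simp only: norm_of_real) simp
qed

text \<open>Jordan's inequality, from the concavity of the sine between \<open>0\<close> and \<open>\<pi> / 2\<close>.\<close>

lemma sin_pi_ge:
  assumes "0 \<le> x" "x \<le> 1 / 2"
  shows "2 * x \<le> sin (pi * x)"
proof -
  have conc: "concave_on {0..pi/2} sin"
    unfolding concave_on_def
    by (rule f''_ge0_imp_convex[where f' = "\<lambda>x. - cos x" and f'' = "\<lambda>x. sin x"])
       (auto intro!: derivative_eq_intros sin_ge_zero)
  have "(1 - 2*x) * sin 0 + (2*x) * sin (pi/2) \<le> sin ((1 - 2*x) *\<^sub>R 0 + (2*x) *\<^sub>R (pi/2))"
    using assms by (intro concave_onD[OF conc]) auto
  thus ?thesis by (simp add: algebra_simps)
qed

lemma norm_one_minus_cis: "norm (1 - cis (2 * t)) = 2 * \<bar>sin t\<bar>"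
proof -
  have "1 - cis (2 * t) = (- 2 * \<i> * sin t) * cis t"
    by (rule complex_eqI) (auto simp: cos_double_sin sin_double power2_eq_square)
  thus ?thesis by (simp add: norm_mult)
qed

lemma norm_one_minus_fourier_char_ge:
  assumes "0 \<le> x" "x \<le> 1"
  shows "norm (1 - fourier_char (-1) x) \<ge> 4 * min x (1 - x)"
proof -
  have "2 * min x (1 - x) \<le> sin (pi * min x (1 - x))"
    using assms by (intro sin_pi_ge) (auto simp: min_def)
  also have "sin (pi * min x (1 - x)) = sin (pi * x)"
    by (auto simp: min_def ring_distribs)
  also have "sin (pi * x) \<le> \<bar>sin (- pi * x)\<bar>" by simp
  finally show ?thesis using norm_one_minus_cis[of "- pi * x"] by (simp add: mult_ac)
qed

text \<open>The kernel is at most \<open>K\<close>, the number of its terms, and, summed as a geometric series, at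
  most \<open>1 / (2 t)\<close>, where \<open>t\<close> is the distance of \<open>x\<close> to the nearest integer. The minimum of
  two positive numbers is at most their harmonic mean, which for these two is
  \<open>2 K / (1 + 2 K t)\<close>; unlike the minimum, it has an elementary antiderivative on the whole
  interval. The two terms of the bound serve the two integers nearest to \<open>x\<close>.\<close>

lemma dirichlet_kernel_bound:
  fixes M N :: nat
  assumes x: "0 \<le> x" "x \<le> 1" and MN: "M < N"
  defines "K \<equiv> real (N - M)"
  shows "norm (\<Sum>n\<in>{int M<..int N}. fourier_char (- n) x)
           \<le> 2 * K / (1 + 2 * K * x) + 2 * K / (1 + 2 * K * (1 - x))"
proof -
  let ?D = "\<Sum>n\<in>{int M<..int N}. fourier_char (- n) x"
  let ?q = "fourier_char (-1) x"
  have K: "K \<ge> 1" using MN by (simp add: K_def)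
  have "norm ?D \<le> (\<Sum>n\<in>{int M<..int N}. 1)"
    by (rule sum_norm_le) simp
  also have "\<dots> = K" using MN by (simp add: K_def nat_diff_distrib of_nat_diff)
  finally have 1: "norm ?D \<le> K" .
  have q: "?q ^ n = fourier_char (- int n) x" for n
    using Complex.DeMoivre[of "2 * pi * of_int (- 1) * x" n]
      by (simp only: of_int_minus of_int_of_nat_eq of_int_1) (simp add: mult_ac)
  have D: "?D = (\<Sum>n=Suc M..N. ?q ^ n)"
    unfolding q by (rule sum.reindex_bij_witness[where i=int and j=nat]) auto
  have "(1 - ?q) * ?D = ?q ^ Suc M - ?q ^ Suc N"
    unfolding D using MN by (subst sum_gp_multiplied) auto
  hence "norm (1 - ?q) * norm ?D = norm (?q ^ Suc M - ?q ^ Suc N)"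
    by (simp only: norm_mult [symmetric])
  also have "\<dots> \<le> norm (?q ^ Suc M) + norm (?q ^ Suc N)" by (rule norm_triangle_ineq4)
  also have "\<dots> = 2" by (simp only: norm_power norm_cis) simp
  finally have 2: "norm (1 - ?q) * norm ?D \<le> 2" .
  have "4 * min x (1 - x) * norm ?D \<le> norm (1 - ?q) * norm ?D"
    by (intro mult_right_mono norm_one_minus_fourier_char_ge x) auto
  with 2 have 3: "2 * min x (1 - x) * norm ?D \<le> 1" by simp
  define m where "m = min x (1 - x)"
  have m: "0 \<le> m" using x by (simp add: m_def)
  have "norm ?D * (1 + 2 * K * m) = norm ?D + K * (2 * m * norm ?D)" by (simp add: algebra_simps)
  also have "\<dots> \<le> K + K * 1"
    using K 1 3 by (intro add_mono mult_left_mono) (auto simp: m_def)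
  finally have "norm ?D * (1 + 2 * K * m) \<le> 2 * K" by simp
  hence "norm ?D \<le> 2 * K / (1 + 2 * K * m)"
    using K m by (subst pos_le_divide_eq) (auto intro: add_pos_nonneg)
  moreover have "2 * K / (1 + 2 * K * x) \<ge> 0" "2 * K / (1 + 2 * K * (1 - x)) \<ge> 0"
    using K x by auto
  ultimately show ?thesis by (cases "x \<le> 1 - x") (auto simp: m_def min_def)
qed

lemma dirichlet_majorant_has_integral:
  assumes "K > 0"
  shows "((\<lambda>x. 2 * K / (1 + 2 * K * x) + 2 * K / (1 + 2 * K * (1 - x))) has_integral
           2 * ln (1 + 2 * K)) {0..1::real}"
proof -
  let ?G = "\<lambda>x. ln (1 + 2 * K * x) - ln (1 + 2 * K * (1 - x))"
  have "((\<lambda>x. 2 * K / (1 + 2 * K * x) + 2 * K / (1 + 2 * K * (1 - x))) has_integral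
          (?G 1 - ?G 0)) {0..1::real}"
  proof (rule fundamental_theorem_of_calculus)
    fix x :: real assume x: "x \<in> {0..1}"
    have pos: "1 + 2 * K * x > 0" "1 + 2 * K * (1 - x) > 0"
      using assms x by (auto intro!: add_pos_nonneg)
    show "(?G has_vector_derivative 2 * K / (1 + 2 * K * x) + 2 * K / (1 + 2 * K * (1 - x)))
            (at x within {0..1})"
      unfolding has_real_derivative_iff_has_vector_derivative[symmetric]
      using pos by (auto intro!: derivative_eq_intros)
  qed simp
  thus ?thesis by simp
qed

text \<open>A sharp cut-off of the coefficients costs only a logarithm, namely the \<open>L\<^sup>1\<close> norm of the
  Dirichlet kernel against which the polynomial is integrated.\<close>

lemma trig_poly_coeff_partial_sum_le:
  fixes M N :: nat
  assumes J: "finite J" "{int M<..int N} \<subseteq> J" and MN: "M \<le> N"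
    and bound: "\<And>x. norm (\<Sum>n\<in>J. c n * fourier_char n x) \<le> B"
  shows "norm (\<Sum>n\<in>{int M<..int N}. c n) \<le> 2 * B * ln (1 + 2 * real (N - M))"
proof (cases "M = N")
  case False
  define K where "K = real (N - M)"
  have MN: "M < N" using False MN by simp
  have K: "K > 0" using MN by (simp add: K_def)
  have B: "B \<ge> 0" using order.trans[OF norm_ge_zero bound] .
  let ?F = "\<lambda>x. \<Sum>n\<in>J. c n * fourier_char n x"
  let ?D = "\<lambda>x. \<Sum>n\<in>{int M<..int N}. fourier_char (- n) x"
  let ?m = "\<lambda>x. B * (2 * K / (1 + 2 * K * x) + 2 * K / (1 + 2 * K * (1 - x)))"
  have 1: "((\<lambda>x. ?F x * ?D x) has_integral (\<Sum>n\<in>{int M<..int N}. c n)) {0..1}"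
    using trig_poly_product_has_integral[of J "{int M<..int N}" c "\<lambda>_. 1"] J by simp
  have 2: "(?m has_integral B * (2 * ln (1 + 2 * K))) {0..1}"
    by (intro has_integral_mult_right dirichlet_majorant_has_integral K)
  have "norm (integral {0..1} (\<lambda>x. ?F x * ?D x)) \<le> integral {0..1} ?m"
  proof (rule integral_norm_bound_integral)
    fix x :: real assume "x \<in> {0..1}"
    thus "norm (?F x * ?D x) \<le> ?m x"
      unfolding norm_mult using dirichlet_kernel_bound[of x M N] MN B
      by (intro mult_mono bound) (auto simp: K_def)
  qed (use 1 2 in blast)+
  thus ?thesis unfolding integral_unique[OF 1] integral_unique[OF 2] by (simp add: K_def)
qed simp

section \<open>Coefficients of bounded automorphic functions\<close>

lemma sum_int_interval_eq_sum_nat: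
  "(\<Sum>n\<in>{int M<..int N}. g n) = (\<Sum>n\<in>{M<..N}. g (int n))"
  by (rule sum.reindex_bij_witness[where i = int and j = nat]) auto

lemma norm_summation_by_parts_le:
  fixes a v :: "nat \<Rightarrow> complex"
  assumes "M \<le> N" and P: "\<And>k. M \<le> k \<Longrightarrow> k \<le> N \<Longrightarrow> norm (\<Sum>n\<in>{M<..k}. a n) \<le> P"
  shows "norm (\<Sum>n\<in>{M<..N}. a n * v n) \<le> P * (norm (v N) + (\<Sum>n\<in>{M<..<N}. norm (v n - v (Suc n))))"
proof -
  define T where "T k = (\<Sum>n\<in>{M<..k}. a n)" for k
  have TM: "T M = 0" by (simp add: T_def)
  have "(\<Sum>n\<in>{M<..N}. a n * v n) = T N * v N + (\<Sum>n\<in>{M..<N}. T n * (v n - v (Suc n)))"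
    using \<open>M \<le> N\<close>
  proof (induction N rule: dec_induct)
    case (step k)
    have "{M<..Suc k} = insert (Suc k) {M<..k}" "{M..<Suc k} = insert k {M..<k}"
      using step.hyps by auto
    thus ?case using step.IH by (simp add: T_def algebra_simps)
  qed (simp add: TM)
  also have "(\<Sum>n\<in>{M..<N}. T n * (v n - v (Suc n))) = (\<Sum>n\<in>{M<..<N}. T n * (v n - v (Suc n)))"
    by (rule sum.mono_neutral_right) (auto simp: TM intro: ccontr)
  also have "norm (T N * v N + \<dots>) \<le> norm (T N) * norm (v N) +
      (\<Sum>n\<in>{M<..<N}. norm (T n) * norm (v n - v (Suc n)))"
    by (intro order.trans[OF norm_triangle_ineq] add_mono order.trans[OF norm_sum])
       (auto simp: norm_mult)
  also have "\<dots> \<le> P * norm (v N) + (\<Sum>n\<in>{M<..<N}. P * norm (v n - v (Suc n)))"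
    using assms by (intro add_mono sum_mono mult_right_mono) (auto simp: T_def)
  finally show ?thesis by (simp add: sum_distrib_left ring_distribs)
qed

lemma exp_neg_abs_summable_on_int:
  fixes b :: real
  assumes "b > 0"
  shows "(\<lambda>n::int. exp (- b * \<bar>of_int n\<bar>)) summable_on I"
proof -
  let ?f = "\<lambda>n::int. exp (- b * \<bar>of_int n\<bar>)"
  have "summable (\<lambda>n::nat. exp (- b) ^ n)"
    using assms by (intro summable_geometric) simp
  also have "(\<lambda>n::nat. exp (- b) ^ n) = (\<lambda>n. exp (- b * real n))"
    by (simp add: exp_of_nat_mult [symmetric] mult_ac)
  finally have "(\<lambda>n. exp (- b * real n)) summable_on UNIV"
    by (subst summable_on_UNIV_nonneg_real_iff) auto
  hence "?f summable_on range int" "?f summable_on range (\<lambda>n. - int n)"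
    by (subst summable_on_reindex; simp add: o_def inj_on_def)+
  hence "?f summable_on (range int \<union> range (\<lambda>n. - int n))" by (rule summable_on_union)
  moreover have "range int \<union> range (\<lambda>n. - int n) = UNIV"
  proof -
    have "n \<in> range int \<union> range (\<lambda>n. - int n)" for n :: int
      by (cases n rule: int_cases2) auto
    thus ?thesis by blast
  qed
  ultimately show ?thesis using summable_on_subset by (metis subset_UNIV)
qed

text \<open>The image of \<open>z = x + i y\<close> under a matrix with bottom row \<open>(k, -h)\<close> has imaginary part
  \<open>y / ((k x - h)\<^sup>2 + (k y)\<^sup>2)\<close>. Dirichlet approximation of \<open>x\<close> with denominators up to about
  \<open>1 / sqrt y\<close> makes the denominator at most \<open>5 y\<close>. Points above the line \<open>Im z = 1 / 5\<close> thus
  do the work of a fundamental domain.\<close>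

lemma exists_modular_image_Im_ge:
  assumes "Im z > 0"
  obtains a b c d :: int where "a * d - b * c = 1"
    "Im ((of_int a * z + of_int b) / (of_int c * z + of_int d)) \<ge> 1 / 5"
proof (cases "Im z \<ge> 1 / 5")
  case True
  thus ?thesis using that[of 1 1 0 0] by simp
next
  case False
  define y where "y = Im z"
  have y: "0 < y" "y < 1 / 5" using assms False by (auto simp: y_def)
  define N where "N = nat \<lceil>1 / sqrt y\<rceil>"
  have N1: "real N \<ge> 1 / sqrt y" unfolding N_def by linarith
  have "\<lceil>1 / sqrt y\<rceil> \<ge> 1" using y by (simp add: le_ceiling_iff)
  hence N2: "real N \<le> 1 / sqrt y + 1" and N0: "N > 0" unfolding N_def by linarith+
  obtain h k :: int where hk: "coprime h k" "0 < k" "k \<le> int N"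
      "\<bar>of_int k * Re z - of_int h\<bar> < 1 / N"
    using Dirichlet_approx_coprime[OF N0, of "Re z"] by blast
  obtain u v :: int where uv: "u * h + v * k = 1"
    using bezout_int[of h k] hk(1) by auto
  define w where "w = of_int k * z + of_int (- h)"
  have Im: "Im w = of_int k * y" and Re: "Re w = of_int k * Re z - of_int h"
    by (simp_all add: w_def y_def)
  have w0: "w \<noteq> 0" using Im hk(2) y by (auto simp: complex_eq_iff)
  have sq: "sqrt y * sqrt y = y" "sqrt y \<le> 1" "sqrt y > 0" using y by auto
  have "\<bar>Re w\<bar> \<le> 1 / N" unfolding Re using hk(4) by simp
  also have "\<dots> \<le> sqrt y" using N1 N0 sq by (simp add: field_simps)
  finally have 1: "(Re w)\<^sup>2 \<le> y"
    using y by (metis abs_le_square_iff abs_of_nonneg real_sqrt_ge_zero real_sqrt_pow2 less_imp_le)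
  have "of_int k * y \<le> (1 / sqrt y + 1) * y"
    using hk(3) N2 y by (intro mult_right_mono) linarith+
  also have "\<dots> = sqrt y + y" using sq by (simp add: field_simps)
  also have "\<dots> \<le> 2 * sqrt y" using mult_right_mono[OF sq(2), of "sqrt y"] sq by simp
  finally have "(Im w)\<^sup>2 \<le> (2 * sqrt y)\<^sup>2" unfolding Im using hk(2) y by (intro power_mono) auto
  hence 2: "(Im w)\<^sup>2 \<le> 4 * y" using y by (simp add: power_mult_distrib)
  have nw: "(Re w)\<^sup>2 + (Im w)\<^sup>2 > 0" using w0 by (simp add: complex_neq_0)
  have "Im ((of_int (-u) * z + of_int (-v)) / w) = (u * h + v * k) * y / ((Re w)\<^sup>2 + (Im w)\<^sup>2)"
    by (simp add: Im_divide Im Re y_def w_def algebra_simps)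
  also have "\<dots> = y / ((Re w)\<^sup>2 + (Im w)\<^sup>2)" by (simp add: uv)
  also have "\<dots> \<ge> 1 / 5" using 1 2 nw by (simp add: field_simps)
  finally show ?thesis using that[of "-u" "-h" "-v" k] uv by (simp add: w_def)
qed

text \<open>A setting that covers holomorphic and Maass forms at once: \<open>h\<close> is a function with
  \<open>SL(2,\<int>)\<close>-invariant absolute value, and \<open>W\<close> is the Whittaker function of its Fourier expansion.
  For a holomorphic form of weight \<open>\<kappa>\<close>, \<open>h(z) = (Im z)\<^bsup>\<kappa>/2\<^esup> f(z)\<close> and
  \<open>W(u) = (u / 2\<pi>)\<^bsup>(\<kappa>-1)/2\<^esup> e\<^bsup>-u\<^esup>\<close>; for a Maass form, \<open>h = f\<close> and \<open>W = 2 K\<^bsub>i\<nu>\<^esub>\<close>.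
  The exponents \<open>-u / 2\<close> and \<open>-2 u\<close> leave room around the true decay \<open>e\<^bsup>-u\<^esup>\<close>, up to powers of
  \<open>u\<close>, that both functions have.\<close>

locale whittaker_expansion =
  fixes h :: "complex \<Rightarrow> complex" and A :: "int \<Rightarrow> complex" and W :: "real \<Rightarrow> complex" and I :: "int set"
  assumes index: "{1..} \<subseteq> I" "0 \<notin> I"
    and invariant: "\<And>a b c d z. a * d - b * c = 1 \<Longrightarrow> Im z > 0 \<Longrightarrow>
       norm (h ((of_int a * z + of_int b) / (of_int c * z + of_int d))) = norm (h z)"
    and expansion: "\<And>x y. y > 0 \<Longrightarrow>
       ((\<lambda>n. of_real (sqrt y) * A n * W (2 * pi * \<bar>of_int n\<bar> * y) * fourier_char n x)
          has_sum h (Complex x y)) I"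
    and decay: "\<exists>C. \<forall>u\<ge>1. norm (W u) \<le> C * exp (- u / 2)"
    and lower: "\<exists>c>0. \<exists>u0>0. \<forall>u\<ge>u0. c * exp (- 2 * u) \<le> norm (W u)"
    and lipschitz: "\<And>a b. 0 < a \<Longrightarrow> \<exists>L. \<forall>u\<in>{a..b}. \<forall>v\<in>{a..b}. norm (W u - W v) \<le> L * \<bar>u - v\<bar>"
begin

definition fcoeff :: "real \<Rightarrow> int \<Rightarrow> complex" where
  "fcoeff y n = of_real (sqrt y) * A n * W (2 * pi * \<bar>of_int n\<bar> * y)"

lemma fcoeff_has_sum: "y > 0 \<Longrightarrow> ((\<lambda>n. fcoeff y n * fourier_char n x) has_sum h (Complex x y)) I"
  using expansion by (simp add: fcoeff_def)

lemma fcoeff_abs_summable: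
  assumes "y > 0" shows "(\<lambda>n. norm (fcoeff y n)) summable_on I"
proof -
  have "(\<lambda>n. fcoeff y n * fourier_char n 0) summable_on I"
    using fcoeff_has_sum[OF assms] by (rule has_sum_imp_summable)
  thus ?thesis by (simp add: summable_on_iff_abs_summable_on_complex)
qed

text \<open>Convergence of the expansion at one height already limits the growth of the coefficients,
  because \<open>W\<close> does not decay too fast; the smaller the height, the smaller the exponential rate.\<close>

lemma coefficient_growth: "\<exists>C\<ge>0. \<forall>n\<in>I. norm (A n) \<le> C * exp (pi * \<bar>of_int n\<bar> / 10)"
proof -
  obtain c u0 where cu: "c > 0" "u0 > 0" "\<And>u. u \<ge> u0 \<Longrightarrow> c * exp (- 2 * u) \<le> norm (W u)"
    using lower by auto
  \<comment> \<open>At height \<open>1/40\<close> the argument of \<open>W\<close> is \<open>\<pi>|n|/20\<close>, where the lower bound for \<open>W\<close> is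
      a constant times \<open>exp (-\<pi>|n|/10)\<close>.\<close>
  define M where "M = (\<Sum>\<^sub>\<infinity>n\<in>I. norm (fcoeff (1/40) n))"
  have M: "norm (fcoeff (1/40) n) \<le> M" if "n \<in> I" for n
    using finite_sum_le_infsum[OF fcoeff_abs_summable[of "1/40"], of "{n}"] that
      by (simp add: M_def)
  have M0: "M \<ge> 0" unfolding M_def by (rule infsum_nonneg) simp
  define q where "q = sqrt (1/40 :: real)"
  have q: "q > 0" by (simp add: q_def)
  define N where "N = \<lceil>20 * u0 / pi\<rceil>"
  define C where "C = M / (q * c) + (\<Sum>n\<in>{-N..N}. norm (A n))"
  have C0: "C \<ge> 0" using M0 q cu(1) by (auto simp: C_def intro!: add_nonneg_nonneg sum_nonneg)
  have "norm (A n) \<le> C * exp (pi * \<bar>of_int n\<bar> / 10)" if n: "n \<in> I" for n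
  proof (cases "pi * \<bar>of_int n\<bar> / 20 \<ge> u0")
    case True
    have "q * norm (A n) * (c * exp (- 2 * (pi * \<bar>of_int n\<bar> / 20)))
          \<le> q * norm (A n) * norm (W (pi * \<bar>of_int n\<bar> / 20))"
      using q by (intro mult_left_mono cu(3) True) auto
    also have "\<dots> = norm (fcoeff (1/40) n)" by (simp add: fcoeff_def norm_mult q_def)
    also have "\<dots> \<le> M" by (rule M[OF n])
    finally have "norm (A n) \<le> M / (q * c) * exp (pi * \<bar>of_int n\<bar> / 10)"
      using q cu(1) by (simp add: field_simps exp_minus)
    also have "\<dots> \<le> C * exp (pi * \<bar>of_int n\<bar> / 10)"
      by (intro mult_right_mono) (auto simp: C_def intro: sum_nonneg)
    finally show ?thesis .
  next
    case False
    hence "\<bar>of_int n\<bar> < 20 * u0 / pi" by (simp add: field_simps)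
    hence "\<bar>n\<bar> \<le> N" unfolding N_def by linarith
    hence "norm (A n) \<le> (\<Sum>n\<in>{-N..N}. norm (A n))" by (intro member_le_sum) auto
    also have "\<dots> \<le> C" using M0 q cu(1) by (simp add: C_def)
    also have "\<dots> \<le> C * exp (pi * \<bar>of_int n\<bar> / 10)"
      using mult_left_mono[OF _ C0, of 1 "exp (pi * \<bar>of_int n\<bar> / 10)"] by simp
    finally show ?thesis .
  qed
  thus ?thesis using C0 by blast
qed

text \<open>For \<open>Im z = y \<ge> 1 / 5\<close> the decay \<open>exp (-\<pi> |n| y)\<close> of \<open>W\<close> beats both the growth
  \<open>exp (\<pi> |n| / 10)\<close> of the coefficients and the factor \<open>sqrt y\<close>.\<close>

lemma bounded_near_cusp: "\<exists>B. \<forall>z. Im z \<ge> 1 / 5 \<longrightarrow> norm (h z) \<le> B"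
proof -
  obtain C where C: "C \<ge> 0" "\<And>n. n \<in> I \<Longrightarrow> norm (A n) \<le> C * exp (pi * \<bar>of_int n\<bar> / 10)"
    using coefficient_growth by auto
  obtain D where D: "\<And>u. u \<ge> 1 \<Longrightarrow> norm (W u) \<le> D * exp (- u / 2)" using decay by auto
  have "0 \<le> D * exp (- 1 / 2)" using D[of 1] norm_ge_zero[of "W 1"] by linarith
  hence D0: "D \<ge> 0" by (simp add: zero_le_mult_iff)
  define b where "b = (\<lambda>n::int. C * D * exp (- (pi / 20) * \<bar>of_int n\<bar>))"
  have b: "b summable_on I"
    unfolding b_def by (intro summable_on_cmult_right exp_neg_abs_summable_on_int) simp
  have "norm (h z) \<le> infsum b I" if z: "Im z \<ge> 1 / 5" for z
  proof (rule norm_infsum_le)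
    show "(b has_sum infsum b I) I" by (rule has_sum_infsum[OF b])
    show "((\<lambda>n. fcoeff (Im z) n * fourier_char n (Re z)) has_sum h z) I"
      using fcoeff_has_sum[of "Im z" "Re z"] z by simp
    fix n assume n: "n \<in> I"
    define k where "k = real_of_int \<bar>n\<bar>"
    have k: "k \<ge> 1" using n index(2) by (cases "n = 0") (auto simp: k_def)
    define y where "y = Im z"
    have y: "y \<ge> 1/5" using z by (simp add: y_def)
    have "1 * (1/5) \<le> k * y" using k y by (intro mult_mono) auto
    moreover have "2 * pi * (k * y) \<ge> 2 * 3 * (k * y)"
      using pi_gt3 k y by (intro mult_right_mono) auto
    ultimately have u: "2 * pi * k * y \<ge> 1" by (simp add: mult.assoc)
    have ye: "sqrt y \<le> exp (pi * y / 4)"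
    proof -
      have "0 \<le> (1 - sqrt y)\<^sup>2" by simp
      hence "sqrt y \<le> 1 + (3/4) * y" using y by (simp add: power2_diff)
      also have "\<dots> \<le> 1 + pi * y / 4" using pi_gt3 y by simp
      also have "\<dots> \<le> exp (pi * y / 4)" by (rule exp_ge_add_one_self)
      finally show ?thesis .
    qed
    have "y * 1 \<le> y * k" "k * (1/5) \<le> k * y" using k y by (intro mult_left_mono; simp)+
    hence "y / 4 + k / 10 - k * y \<le> - k / 20" by (simp add: mult_ac)
    hence "pi * (y / 4 + k / 10 - k * y) \<le> pi * (- k / 20)" by (intro mult_left_mono) auto
    hence ex: "pi * y / 4 + pi * k / 10 - pi * k * y \<le> - (pi / 20) * k" by (simp add: algebra_simps)
    have "norm (fcoeff y n * fourier_char n (Re z))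
        = sqrt y * norm (A n) * norm (W (2 * pi * k * y))"
      using y by (simp add: fcoeff_def norm_mult k_def)
    also have "\<dots> \<le> exp (pi * y / 4) * (C * exp (pi * k / 10)) * (D * exp (- (2 * pi * k * y) / 2))"
      using C(2)[OF n] D[OF u] ye C(1) y by (intro mult_mono) (auto simp: k_def)
    also have "\<dots> = C * D * (exp (pi * y / 4) * exp (pi * k / 10) * exp (- (pi * k * y)))"
      by simp
    also have "\<dots> = C * D * exp (pi * y / 4 + pi * k / 10 - pi * k * y)"
      by (simp only: exp_add[symmetric] diff_conv_add_uminus)
    also have "\<dots> \<le> C * D * exp (- (pi / 20) * k)"
      using ex C(1) D0 by (intro mult_left_mono) auto
    finally show "norm (fcoeff (Im z) n * fourier_char n (Re z)) \<le> b n"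
      by (simp add: b_def k_def y_def)
  qed
  thus ?thesis by blast
qed

lemma bounded_on_uhp: "\<exists>B\<ge>0. \<forall>z. Im z > 0 \<longrightarrow> norm (h z) \<le> B"
proof -
  obtain B where B: "\<And>z. Im z \<ge> 1 / 5 \<Longrightarrow> norm (h z) \<le> B" using bounded_near_cusp by blast
  have "norm (h z) \<le> B" if z: "Im z > 0" for z
  proof -
    obtain a b c d :: int where "a * d - b * c = 1"
      "Im ((of_int a * z + of_int b) / (of_int c * z + of_int d)) \<ge> 1 / 5"
      using exists_modular_image_Im_ge[OF z] .
    thus ?thesis using B invariant[of a d b c z] z by fastforce
  qed
  moreover have "B \<ge> 0" by (rule order.trans[OF norm_ge_zero B[of \<i>]]) simp
  ultimately show ?thesis by blast
qed

text \<open>Since the expansion converges absolutely, its finite parts can be chosen arbitrarily close to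
  \<open>h\<close>, uniformly along a horizontal line. Hence they are bounded like \<open>h\<close>, by a constant
  that depends neither on the height \<open>y\<close> nor on the set \<open>S\<close> of frequencies to be included.\<close>

lemma uniformly_bounded_truncations:
  obtains B where "B \<ge> 0"
    "\<forall>y>0. \<forall>S. finite S \<longrightarrow> S \<subseteq> I \<longrightarrow>
      (\<exists>J. finite J \<and> S \<subseteq> J \<and> (\<forall>x. norm (\<Sum>n\<in>J. fcoeff y n * fourier_char n x) \<le> B))"
proof -
  obtain B where B: "B \<ge> 0" "\<And>z. Im z > 0 \<Longrightarrow> norm (h z) \<le> B" using bounded_on_uhp by blast
  have "\<exists>J. finite J \<and> S \<subseteq> J \<and> (\<forall>x. norm (\<Sum>n\<in>J. fcoeff y n * fourier_char n x) \<le> B + 1)"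
    if y: "y > 0" and S: "finite S" "S \<subseteq> I" for y S
  proof -
    let ?f = "\<lambda>n. norm (fcoeff y n)"
    note summ = fcoeff_abs_summable[OF y]
    obtain J0 where J0: "finite J0" "J0 \<subseteq> I" "dist (sum ?f J0) (infsum ?f I) \<le> 1"
      using has_sum_finite_approximation[OF has_sum_infsum[OF summ], of 1] by auto
    define J where "J = J0 \<union> S"
    have J: "finite J" "J \<subseteq> I" "S \<subseteq> J" using J0 S by (auto simp: J_def)
    have "sum ?f J0 \<le> sum ?f J" using J by (intro sum_mono2) (auto simp: J_def)
    hence tail: "infsum ?f I - sum ?f J \<le> 1" using J0(3) by (simp add: dist_real_def)
    have "(?f has_sum (infsum ?f I - sum ?f J)) (I - J)"
      using J summ by (intro has_sum_Diff has_sum_infsum has_sum_finite) auto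
    hence tail_sum: "((\<lambda>n. norm (fcoeff y n * fourier_char n x))
        has_sum (infsum ?f I - sum ?f J)) (I - J)" for x
      by (simp add: norm_mult)
    have "norm (\<Sum>n\<in>J. fcoeff y n * fourier_char n x) \<le> B + 1" for x
    proof -
      let ?s = "\<Sum>n\<in>J. fcoeff y n * fourier_char n x"
      have "((\<lambda>n. fcoeff y n * fourier_char n x) has_sum (h (Complex x y) - ?s)) (I - J)"
        using J by (intro has_sum_Diff fcoeff_has_sum y has_sum_finite) auto
      hence "norm (h (Complex x y) - ?s) \<le> infsum ?f I - sum ?f J"
        using norm_has_sum_bound[OF tail_sum] by blast
      moreover have "norm (h (Complex x y)) \<le> B" using y by (intro B) simp
      moreover have "norm ?s \<le> norm (h (Complex x y)) + norm (h (Complex x y) - ?s)"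
        using norm_triangle_sub[of ?s "h (Complex x y)"] by (simp add: norm_minus_commute)
      ultimately show ?thesis using tail by linarith
    qed
    thus ?thesis using J by blast
  qed
  thus ?thesis using B(1) by (intro that[of "B + 1"]) auto
qed

lemma whittaker_lower_bound:
  obtains w u0 where "w > 0" "u0 > 0"
    "\<forall>u\<in>{u0..2 * u0}. w \<le> norm (W u)"
proof -
  obtain c u0 where cu: "c > 0" "u0 > 0" "\<And>u. u \<ge> u0 \<Longrightarrow> c * exp (- 2 * u) \<le> norm (W u)"
    using lower by auto
  have "c * exp (- 4 * u0) \<le> norm (W u)" if "u \<in> {u0..2 * u0}" for u
    by (rule order.trans[OF _ cu(3)]) (use that cu(1) in auto)
  thus ?thesis using that[of "c * exp (- 4 * u0)" u0] cu by simp
qed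

text \<open>At height \<open>u0 / (\<pi> N)\<close> the indices from \<open>N / 2\<close> to \<open>N\<close> have their Whittaker arguments between
  \<open>u0\<close> and \<open>2 u0\<close>, where \<open>W\<close> is bounded below. Bessel's inequality on that line therefore
  bounds the coefficients themselves.\<close>

lemma block_mean_square:
  "\<exists>C\<ge>0. \<forall>N. (\<Sum>n\<in>{N div 2<..N}. (norm (A (int n)))\<^sup>2) \<le> C * real N"
proof -
  obtain B where B: "B \<ge> 0" "\<forall>y>0. \<forall>S. finite S \<longrightarrow> S \<subseteq> I \<longrightarrow>
      (\<exists>J. finite J \<and> S \<subseteq> J \<and> (\<forall>x. norm (\<Sum>n\<in>J. fcoeff y n * fourier_char n x) \<le> B))"
    using uniformly_bounded_truncations .
  obtain w u0 where w: "w > 0" "u0 > 0" "\<forall>u\<in>{u0..2 * u0}. w \<le> norm (W u)"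
    using whittaker_lower_bound .
  have "(\<Sum>n\<in>{N div 2<..N}. (norm (A (int n)))\<^sup>2) \<le> (B\<^sup>2 * pi / (u0 * w\<^sup>2)) * real N" for N
  proof (cases "N = 0")
    case False
    define y where "y = u0 / (pi * real N)"
    have y: "y > 0" using False w by (simp add: y_def)
    define S where "S = {int (N div 2)<..int N}"
    have S: "finite S" "S \<subseteq> I" using index(1) by (auto simp: S_def)
    obtain J where J: "finite J" "S \<subseteq> J" "\<forall>x. norm (\<Sum>n\<in>J. fcoeff y n * fourier_char n x) \<le> B"
      using B(2)[rule_format, OF y S] by (elim exE conjE) (rule that)
    have "y * w\<^sup>2 * (\<Sum>n\<in>{N div 2<..N}. (norm (A (int n)))\<^sup>2)
        = (\<Sum>n\<in>{N div 2<..N}. (sqrt y * norm (A (int n)) * w)\<^sup>2)"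
      using y by (simp add: sum_distrib_left power_mult_distrib mult_ac)
    also have "\<dots> \<le> (\<Sum>n\<in>{N div 2<..N}. (norm (fcoeff y (int n)))\<^sup>2)"
    proof (rule sum_mono)
      fix n assume n: "n \<in> {N div 2<..N}"
      hence "real N \<le> 2 * real n" "real n \<le> real N" by auto
      hence "2 * pi * \<bar>of_int (int n)\<bar> * y \<in> {u0..2 * u0}"
        using False w(2) by (auto simp: y_def field_simps)
      hence "w \<le> norm (W (2 * pi * \<bar>of_int (int n)\<bar> * y))" by (rule w(3)[rule_format])
      thus "(sqrt y * norm (A (int n)) * w)\<^sup>2 \<le> (norm (fcoeff y (int n)))\<^sup>2"
        using w(1) y unfolding fcoeff_def norm_mult by (intro power_mono mult_mono) auto
    qed
    also have "\<dots> = (\<Sum>n\<in>S. (norm (fcoeff y n))\<^sup>2)"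
      unfolding S_def by (rule sum_int_interval_eq_sum_nat[symmetric])
    also have "\<dots> \<le> (\<Sum>n\<in>J. (norm (fcoeff y n))\<^sup>2)" using J by (intro sum_mono2) auto
    also have "\<dots> \<le> B\<^sup>2" by (rule trig_poly_coeff_sum_squares_le[OF J(1) J(3)[rule_format]])
    finally have "(\<Sum>n\<in>{N div 2<..N}. (norm (A (int n)))\<^sup>2) \<le> B\<^sup>2 / (y * w\<^sup>2)"
      using y w(1) by (simp add: field_simps)
    also have "\<dots> = (B\<^sup>2 * pi / (u0 * w\<^sup>2)) * real N" using False w by (simp add: y_def field_simps)
    finally show ?thesis .
  qed simp
  moreover have "B\<^sup>2 * pi / (u0 * w\<^sup>2) \<ge> 0" using w by simp
  ultimately show ?thesis by blast
qed

theorem mean_square: "\<exists>C\<ge>0. \<forall>N. (\<Sum>n=1..N. (norm (A (int n)))\<^sup>2) \<le> C * real N"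
proof -
  obtain C where C: "C \<ge> 0" "\<And>N. (\<Sum>n\<in>{N div 2<..N}. (norm (A (int n)))\<^sup>2) \<le> C * real N"
    using block_mean_square by blast
  have "(\<Sum>n=1..N. (norm (A (int n)))\<^sup>2) \<le> 2 * C * real N" for N
  proof (induction N rule: less_induct)
    case (less N)
    show ?case
    proof (cases "N = 0")
      case False
      have "{1..N} = {1..N div 2} \<union> {N div 2<..N}" by auto
      hence "(\<Sum>n=1..N. (norm (A (int n)))\<^sup>2)
          = (\<Sum>n=1..N div 2. (norm (A (int n)))\<^sup>2) + (\<Sum>n\<in>{N div 2<..N}. (norm (A (int n)))\<^sup>2)"
        by (subst sum.union_disjoint[symmetric]) auto
      also have "\<dots> \<le> 2 * C * real (N div 2) + C * real N"
        using False by (intro add_mono less C) auto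
      also have "\<dots> \<le> 2 * C * (real N / 2) + C * real N"
        using C(1) by (intro add_right_mono mult_left_mono) linarith+
      finally show ?thesis by simp
    qed simp
  qed
  thus ?thesis using C(1) by (intro exI[of _ "2 * C"]) auto
qed

text \<open>Hecke's argument. On the line at height \<open>u0 / (\<pi> N)\<close> the partial sums of the weighted
  coefficients \<open>sqrt y A(n) W(2 \<pi> n y)\<close> are at most logarithmic. The weight is removed by partial
  summation, as \<open>1 / W\<close> is bounded and Lipschitz between \<open>u0\<close> and \<open>2 u0\<close>. The factor
  \<open>sqrt N\<close> is \<open>1 / sqrt y\<close> up to a constant.\<close>

lemma block_partial_sum:
  "\<exists>C\<ge>0. \<forall>N. norm (\<Sum>n\<in>{N div 2<..N}. A (int n)) \<le> C * sqrt N * ln (1 + 2 * real N)"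
proof -
  obtain B where B: "B \<ge> 0" "\<forall>y>0. \<forall>S. finite S \<longrightarrow> S \<subseteq> I \<longrightarrow>
      (\<exists>J. finite J \<and> S \<subseteq> J \<and> (\<forall>x. norm (\<Sum>n\<in>J. fcoeff y n * fourier_char n x) \<le> B))"
    using uniformly_bounded_truncations .
  obtain w u0 where w: "w > 0" "u0 > 0" "\<forall>u\<in>{u0..2 * u0}. w \<le> norm (W u)"
    using whittaker_lower_bound .
  obtain L where L: "\<forall>u\<in>{u0..2 * u0}. \<forall>v\<in>{u0..2 * u0}. norm (W u - W v) \<le> L * \<bar>u - v\<bar>"
    using lipschitz[OF w(2), of "2 * u0"] ..
  have "0 \<le> L * u0" using order.trans[OF norm_ge_zero L[rule_format, of u0 "2 * u0"]] w(2) by simp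
  hence L0: "L \<ge> 0" using w(2) by (simp add: zero_le_mult_iff)
  \<comment> \<open>\<open>V\<close> bounds the last value plus the total variation of \<open>1 / W\<close> along the block.\<close>
  define V where "V = 1 / w + 2 * u0 * L / w\<^sup>2"
  have V: "V \<ge> 0" using w L0 by (simp add: V_def)
  have "norm (\<Sum>n\<in>{N div 2<..N}. A (int n))
      \<le> (2 * B * sqrt (pi / u0) * V) * sqrt N * ln (1 + 2 * real N)" for N
  proof (cases "N = 0")
    case False
    define y where "y = u0 / (pi * real N)"
    have y: "y > 0" using False w by (simp add: y_def)
    define u where "u n = 2 * pi * \<bar>of_int (int n)\<bar> * y" for n
    have u_eq: "u n = 2 * u0 * real n / real N" for n by (simp add: u_def y_def)
    have u: "u n \<in> {u0..2 * u0}" if "n \<in> {N div 2<..N}" for n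
    proof -
      from that have "real N \<le> 2 * real n" "real n \<le> real N" by auto
      thus ?thesis using False w(2) by (auto simp: u_eq field_simps)
    qed
    have Wu: "W (u n) \<noteq> 0" "1 / norm (W (u n)) \<le> 1 / w" if "n \<in> {N div 2<..N}" for n
      using w(3)[rule_format, OF u[OF that]] w(1) by (auto intro!: divide_left_mono mult_pos_pos)
    define v where "v n = 1 / W (u n)" for n
    define P where "P = 2 * B * ln (1 + 2 * real N) / sqrt y"
    have P0: "P \<ge> 0" using B y by (simp add: P_def)
    have "(\<Sum>n\<in>{N div 2<..N}. A (int n)) = (\<Sum>n\<in>{N div 2<..N}. (fcoeff y (int n) / sqrt y) * v n)"
    proof (rule sum.cong)
      fix n assume "n \<in> {N div 2<..N}"
      thus "A (int n) = (fcoeff y (int n) / sqrt y) * v n"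
        using Wu(1)[of n] y by (simp add: fcoeff_def v_def u_def)
    qed simp
    also have "norm \<dots> \<le> P * (norm (v N) + (\<Sum>n\<in>{N div 2<..<N}. norm (v n - v (Suc n))))"
    proof (rule norm_summation_by_parts_le)
      fix k assume k: "N div 2 \<le> k" "k \<le> N"
      define S where "S = {int (N div 2)<..int k}"
      have S: "finite S" "S \<subseteq> I" using index(1) by (auto simp: S_def)
      obtain J where J: "finite J" "S \<subseteq> J" "\<forall>x. norm (\<Sum>n\<in>J. fcoeff y n * fourier_char n x) \<le> B"
        using B(2)[rule_format, OF y S] by (elim exE conjE) (rule that)
      have "norm (\<Sum>n\<in>{N div 2<..k}. fcoeff y (int n)) \<le> 2 * B * ln (1 + 2 * real (k - N div 2))"
        using trig_poly_coeff_partial_sum_le[OF J(1) J(2)[unfolded S_def] k(1) J(3)[rule_format]]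
        unfolding sum_int_interval_eq_sum_nat .
      also have "\<dots> \<le> 2 * B * ln (1 + 2 * real N)" using k B(1) by (intro mult_left_mono) auto
      finally show "norm (\<Sum>n\<in>{N div 2<..k}. fcoeff y (int n) / sqrt y) \<le> P"
        using y by (simp add: P_def sum_divide_distrib[symmetric] norm_divide divide_right_mono)
    qed simp
    also have "\<dots> \<le> P * V"
    proof (intro mult_left_mono P0)
      have "norm (v N) \<le> 1 / w" using Wu(2)[of N] False by (simp add: v_def norm_divide)
      moreover have "(\<Sum>n\<in>{N div 2<..<N}. norm (v n - v (Suc n)))
          \<le> (\<Sum>n\<in>{N div 2<..<N}. L * (2 * u0 / N) / w\<^sup>2)"
      proof (rule sum_mono)
        fix n assume "n \<in> {N div 2<..<N}"
        hence n: "n \<in> {N div 2<..N}" "Suc n \<in> {N div 2<..N}" by auto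
        have "norm (v n - v (Suc n))
            = norm (W (u (Suc n)) - W (u n)) * ((1 / norm (W (u n))) * (1 / norm (W (u (Suc n)))))"
          using Wu(1)[OF n(1)] Wu(1)[OF n(2)]
            unfolding v_def norm_mult[symmetric] norm_divide[symmetric] norm_one[symmetric]
          by (simp add: field_simps norm_mult[symmetric] norm_divide[symmetric])
        also have "\<dots> \<le> (L * (2 * u0 / N)) * ((1 / w) * (1 / w))"
        proof (intro mult_mono Wu(2) n)
          have "norm (W (u (Suc n)) - W (u n)) \<le> L * \<bar>u (Suc n) - u n\<bar>"
            by (intro L[rule_format] u n)
          also have "u (Suc n) - u n = 2 * u0 / N" using False by (simp add: u_eq field_simps)
          finally show "norm (W (u (Suc n)) - W (u n)) \<le> L * (2 * u0 / N)" using w(2) by simp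
        qed (use L0 w in auto)
        finally show "norm (v n - v (Suc n)) \<le> L * (2 * u0 / N) / w\<^sup>2"
          by (simp add: power2_eq_square)
      qed
      moreover have "\<dots> \<le> real N * (L * (2 * u0 / N) / w\<^sup>2)"
        unfolding sum_constant using L0 w by (intro mult_right_mono) auto
      moreover have "\<dots> = 2 * u0 * L / w\<^sup>2" using False by simp
      ultimately show "norm (v N) + (\<Sum>n\<in>{N div 2<..<N}. norm (v n - v (Suc n))) \<le> V"
        unfolding V_def by linarith
    qed
    also have "P * V = (2 * B * sqrt (pi / u0) * V) * sqrt N * ln (1 + 2 * real N)"
      by (simp add: P_def y_def real_sqrt_divide real_sqrt_mult)
    finally show ?thesis .
  qed simp
  moreover have "2 * B * sqrt (pi / u0) * V \<ge> 0" using B w V by simp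
  ultimately show ?thesis by blast
qed

theorem partial_sum: "\<exists>C\<ge>0. \<forall>N. norm (\<Sum>n=1..N. A (int n)) \<le> C * sqrt N * ln (1 + 2 * real N)"
proof -
  obtain C
    where C: "C \<ge> 0" "\<And>N. norm (\<Sum>n\<in>{N div 2<..N}. A (int n)) \<le> C * sqrt N * ln (1 + 2 * real N)"
    using block_partial_sum by blast
  \<comment> \<open>The blocks form a geometric series: \<open>4 C sqrt (1/2) + C \<le> 4 C\<close>.\<close>
  have sqrt_half: "sqrt (1 / 2) \<le> (3 / 4 :: real)"
    by (rule real_le_lsqrt) (auto simp: power2_eq_square)
  have "norm (\<Sum>n=1..N. A (int n)) \<le> 4 * C * sqrt N * ln (1 + 2 * real N)" for N
  proof (induction N rule: less_induct)
    case (less N)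
    show ?case
    proof (cases "N = 0")
      case False
      define l where "l = ln (1 + 2 * real N)"
      have l: "l \<ge> 0" by (simp add: l_def)
      have "{1..N} = {1..N div 2} \<union> {N div 2<..N}" by auto
      hence "(\<Sum>n=1..N. A (int n)) = (\<Sum>n=1..N div 2. A (int n)) + (\<Sum>n\<in>{N div 2<..N}. A (int n))"
        by (subst sum.union_disjoint[symmetric]) auto
      also have "norm \<dots> \<le> 4 * C * sqrt (N div 2) * ln (1 + 2 * real (N div 2)) + C * sqrt N * l"
        unfolding l_def
        using False by (intro order.trans[OF norm_triangle_ineq] add_mono less C(2)) auto
      also have "\<dots> \<le> 4 * C * (sqrt N * (3/4)) * l + C * sqrt N * l"
      proof (intro add_right_mono mult_mono)
        have "sqrt (N div 2) \<le> sqrt (real N * (1/2))" by (intro real_sqrt_le_mono) linarith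
        also have "\<dots> = sqrt N * sqrt (1/2)" by (rule real_sqrt_mult)
        also have "\<dots> \<le> sqrt N * (3/4)" by (intro mult_left_mono sqrt_half) simp
        finally show "sqrt (N div 2) \<le> sqrt N * (3/4)" .
        have "real (N div 2) \<le> real N" by simp
        thus "ln (1 + 2 * real (N div 2)) \<le> l" unfolding l_def by simp
      qed (use C(1) l in auto)
      finally show ?thesis by (simp add: l_def)
    qed simp
  qed
  thus ?thesis using C(1) by (intro exI[of _ "4 * C"]) auto
qed

end

section \<open>Holomorphic forms\<close>

text \<open>From the tangent bound for the logarithm at \<open>2 m\<close>, with any positive \<open>m \<ge> a\<close>.\<close>

lemma powr_le_exp_half: "\<exists>C>0. \<forall>u\<ge>1. u powr a \<le> C * exp (u / 2 :: real)"
proof -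
  define m where "m = \<bar>a\<bar> + 1"
  have m: "m > 0" "a \<le> m" by (auto simp: m_def)
  have "u powr a \<le> exp (m * ln (2 * m)) * exp (u / 2)" if u: "u \<ge> 1" for u
  proof -
    have "ln (u / (2 * m)) \<le> u / (2 * m) - 1" using u m by (intro ln_le_minus_one) auto
    hence "ln u \<le> u / (2 * m) + ln (2 * m)" using u m by (simp add: ln_div)
    hence "m * ln u \<le> m * (u / (2 * m) + ln (2 * m))" using m by (intro mult_left_mono) auto
    also have "\<dots> = u / 2 + m * ln (2 * m)" using m by (simp add: field_simps)
    finally have 1: "m * ln u \<le> u / 2 + m * ln (2 * m)" .
    have "a * ln u \<le> m * ln u" using m u by (intro mult_right_mono) auto
    with 1 have "exp (a * ln u) \<le> exp (u / 2 + m * ln (2 * m))" by simp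
    thus ?thesis using u by (simp add: powr_def exp_add mult.commute)
  qed
  thus ?thesis by (intro exI[of _ "exp (m * ln (2 * m))"]) auto
qed

text \<open>The automorphy factor is absorbed by the power of the imaginary part, because
  \<open>Im (\<gamma> z) = Im z / |c z + d|\<^sup>2\<close>.\<close>

lemma norm_modular_factor_powr:
  fixes a b c d \<kappa> :: int
  assumes det: "a * d - b * c = 1" and z: "Im z > 0"
  defines "w \<equiv> of_int c * z + of_int d"
  shows "Im ((of_int a * z + of_int b) / w) powr (of_int \<kappa> / 2) * norm (w powi \<kappa>)
      = Im z powr (of_int \<kappa> / 2)"
proof -
  have w0: "w \<noteq> 0"
  proof
    assume w: "w = 0"
    have "Im w = of_int c * Im z" by (simp add: w_def)
    hence c: "c = 0" using w z by simp
    hence "d = 0" using w by (simp add: w_def)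
    thus False using c det by simp
  qed
  have "Im ((of_int a * z + of_int b) / w) = of_int (a * d - b * c) * Im z / ((Re w)\<^sup>2 + (Im w)\<^sup>2)"
    by (simp add: Im_divide w_def algebra_simps)
  also have "\<dots> = Im z / (norm w)\<^sup>2" unfolding det by (simp add: cmod_power2)
  finally have "Im ((of_int a * z + of_int b) / w) powr (of_int \<kappa> / 2)
      = Im z powr (of_int \<kappa> / 2) / ((norm w)\<^sup>2) powr (of_int \<kappa> / 2)"
    using z by (simp add: powr_divide)
  also have "((norm w)\<^sup>2) powr (of_int \<kappa> / 2) = norm w powr of_int \<kappa>"
    using w0 by (simp add: powr_powr flip: powr_numeral)
  also have "\<dots> = norm (w powi \<kappa>)" using w0 by (simp add: powr_real_of_int' norm_power_int)
  finally show ?thesis using w0 by simp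
qed

lemma holomorphic_whittaker_expansion:
  assumes "holomorphic_cusp_form \<kappa> f" "holomorphic_fourier_coeffs \<kappa> f A"
  shows "whittaker_expansion (\<lambda>z. of_real (Im z powr (of_int \<kappa> / 2)) * f z) A
           (\<lambda>u. of_real ((u / (2 * pi)) powr ((of_int \<kappa> - 1) / 2) * exp (- u))) {1..}"
proof
  define \<alpha> where "\<alpha> = (real_of_int \<kappa> - 1) / 2"
  let ?W = "\<lambda>u. complex_of_real ((u / (2 * pi)) powr ((of_int \<kappa> - 1) / 2) * exp (- u))"
  have W: "norm (?W u) = (2 * pi) powr (- \<alpha>) * u powr \<alpha> * exp (- u)" if "u > 0" for u
    unfolding norm_of_real
      using that by (simp add: abs_mult \<alpha>_def powr_divide powr_minus field_simps)
  show "{1..} \<subseteq> {1::int..}" "(0::int) \<notin> {1..}" by auto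
  show "norm (of_real (Im ((of_int a * z + of_int b) / (of_int c * z + of_int d))
                powr (of_int \<kappa> / 2)) *
              f ((of_int a * z + of_int b) / (of_int c * z + of_int d))) =
        norm (of_real (Im z powr (of_int \<kappa> / 2)) * f z)"
    if det: "a * d - b * c = 1" and z: "Im z > 0" for a b c d z
  proof -
    have "f ((of_int a * z + of_int b) / (of_int c * z + of_int d))
        = (of_int c * z + of_int d) powi \<kappa> * f z"
      using assms(1) det z
      by (auto simp: holomorphic_cusp_form_def modular_invariant_def upper_half_plane_def)
    thus ?thesis
      using norm_modular_factor_powr[OF det z, of \<kappa>] by (simp add: norm_mult mult.assoc[symmetric])
  qed
  show "((\<lambda>n. of_real (sqrt y) * A n * ?W (2 * pi * \<bar>of_int n\<bar> * y) * fourier_char n x)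
          has_sum of_real (Im (Complex x y) powr (of_int \<kappa> / 2)) * f (Complex x y)) {1..}"
    if y: "y > 0" for x y
  proof -
    have "((\<lambda>n. A n * of_real (of_int n powr ((of_int \<kappa> - 1) / 2)) * e2pi (of_int n * Complex x y))
           has_sum f (Complex x y)) {1..}"
      using assms(2) y by (simp add: holomorphic_fourier_coeffs_def upper_half_plane_def)
    hence "((\<lambda>n. of_real (y powr (of_int \<kappa> / 2)) * (A n
        * of_real (of_int n powr ((of_int \<kappa> - 1) / 2)) * e2pi (of_int n * Complex x y)))
           has_sum of_real (y powr (of_int \<kappa> / 2)) * f (Complex x y)) {1..}"
      by (rule has_sum_cmult_right)
    also have "?this \<longleftrightarrow> ?thesis" unfolding complex.sel
    proof (rule has_sum_cong)
      fix n :: int assume n: "n \<in> {1..}"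
      have "e2pi (of_int n * Complex x y) = of_real (exp (- (2 * pi * n * y))) * fourier_char n x"
        by (simp add: e2pi_def exp_eq_polar cis_conv_exp[symmetric] mult_ac)
      moreover have "sqrt y * (2 * pi * \<bar>of_int n\<bar> * y / (2 * pi)) powr \<alpha>
          = y powr (of_int \<kappa> / 2) * of_int n powr \<alpha>"
      proof -
        have "y powr (of_int \<kappa> / 2) = y powr (1 / 2) * y powr \<alpha>"
          by (simp add: powr_add[symmetric] \<alpha>_def field_simps)
        thus ?thesis using n y by (simp add: powr_mult powr_half_sqrt)
      qed
      ultimately show "of_real (y powr (of_int \<kappa> / 2)) * (A n
          * of_real (of_int n powr ((of_int \<kappa> - 1) / 2)) * e2pi (of_int n * Complex x y)) =
          of_real (sqrt y) * A n * ?W (2 * pi * \<bar>of_int n\<bar> * y) * fourier_char n x"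
        using n unfolding \<alpha>_def[symmetric] by (simp add: mult_ac flip: of_real_mult)
    qed
    finally show ?thesis .
  qed
  obtain C where C: "C > 0" "\<And>u. u \<ge> 1 \<Longrightarrow> u powr \<alpha> \<le> C * exp (u / 2)"
    using powr_le_exp_half by blast
  show "\<exists>C. \<forall>u\<ge>1. norm (?W u) \<le> C * exp (- u / 2)"
  proof (intro exI allI impI)
    fix u :: real assume u: "u \<ge> 1"
    have "norm (?W u) \<le> (2 * pi) powr (- \<alpha>) * (C * exp (u / 2)) * exp (- u)"
      using u C by (subst W) (auto intro!: mult_right_mono mult_left_mono)
    also have "\<dots> = ((2 * pi) powr (- \<alpha>) * C) * exp (- u / 2)"
      by (simp add: exp_add[symmetric] mult.assoc)
    finally show "norm (?W u) \<le> ((2 * pi) powr (- \<alpha>) * C) * exp (- u / 2)" .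
  qed
  obtain D where D: "D > 0" "\<And>u. u \<ge> 1 \<Longrightarrow> u powr (- \<alpha>) \<le> D * exp (u / 2)"
    using powr_le_exp_half by blast
  define c where "c = (2 * pi) powr (- \<alpha>) / D"
  have "c * exp (- 2 * u) \<le> norm (?W u)" if u: "u \<ge> 1" for u
  proof -
    have "1 / (D * exp (u / 2)) \<le> 1 / u powr (- \<alpha>)"
      using D(2)[OF u] D(1) u by (intro divide_left_mono) auto
    hence *: "1 / D * exp (- u / 2) \<le> u powr \<alpha>"
      using u by (simp add: powr_minus exp_minus field_simps)
    have "c * exp (- 2 * u) \<le> c * exp (- u / 2 - u)"
      using D u by (intro mult_left_mono) (auto simp: c_def)
    also have "\<dots> = (2 * pi) powr (- \<alpha>) * (1 / D * exp (- u / 2)) * exp (- u)"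
      by (simp add: c_def mult_ac flip: exp_add)
    also have "\<dots> \<le> (2 * pi) powr (- \<alpha>) * u powr \<alpha> * exp (- u)"
      by (intro mult_right_mono mult_left_mono *) auto
    also have "\<dots> = norm (?W u)" using u by (subst W) auto
    finally show ?thesis .
  qed
  moreover have "c > 0" using D by (simp add: c_def)
  ultimately show "\<exists>c>0. \<exists>u0>0. \<forall>u\<ge>u0. c * exp (- 2 * u) \<le> norm (?W u)"
    by (intro exI[of _ c] conjI exI[of _ "1::real"]) auto
  show "\<exists>L. \<forall>u\<in>{p..q}. \<forall>v\<in>{p..q}. norm (?W u - ?W v) \<le> L * \<bar>u - v\<bar>" if p: "0 < p" for p q
  proof -
    define g where "g u = (u / (2 * pi)) powr \<alpha> * exp (- u)" for u
    define g'
      where "g' u = (\<alpha> * (u / (2 * pi)) powr (\<alpha> - 1) / (2 * pi) - (u / (2 * pi)) powr \<alpha>)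
          * exp (- u)" for u
    have "continuous_on {p..q} g'" unfolding g'_def using p by (intro continuous_intros) auto
    hence "bounded (g' ` {p..q})" by (intro compact_imp_bounded compact_continuous_image) auto
    then obtain L where L: "\<forall>u\<in>{p..q}. norm (g' u) \<le> L" by (auto simp: bounded_iff)
    have der: "(g has_field_derivative g' u) (at u within {p..q})" if "u \<in> {p..q}" for u
      using that p unfolding g_def g'_def
      by (auto intro!: derivative_eq_intros simp: algebra_simps powr_diff powr_minus)
    have "norm (?W u - ?W v) \<le> L * \<bar>u - v\<bar>" if "u \<in> {p..q}" "v \<in> {p..q}" for u v
    proof -
      have "norm (g u - g v) \<le> L * norm (u - v)"
        by (rule field_differentiable_bound[OF _ der L[rule_format] that]) auto
      moreover have "?W u - ?W v = of_real (g u - g v)" by (simp add: g_def \<alpha>_def)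
      ultimately show ?thesis by (simp only: norm_of_real) simp
    qed
    thus ?thesis by blast
  qed
qed

section \<open>The Bessel function and Maass forms\<close>

lemma cosh_ge_quadratic: "t \<ge> 0 \<Longrightarrow> t\<^sup>2 / 4 \<le> cosh (t :: real)"
proof -
  assume "t \<ge> 0"
  hence "t\<^sup>2 / 4 \<le> (exp t + 0) / 2" using exp_lower_Taylor_quadratic[of t] by simp
  also have "\<dots> \<le> (exp t + exp (- t)) / 2" by (intro divide_right_mono add_left_mono) auto
  finally show ?thesis by (simp add: cosh_def)
qed

text \<open>Completing the square in \<open>b t - a cosh t \<le> b t - a t\<^sup>2 / 4\<close> gives a majorant that is a multiple
  of \<open>exp (-t)\<close>.\<close>

lemma exp_cosh_set_integrable:
  fixes a b :: real
  assumes a: "a > 0"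
  shows "set_integrable lborel {0..} (\<lambda>t. exp (b * t - a * cosh t))"
proof -
  have "(\<lambda>t. exp (- 1 * t) :: real) absolutely_integrable_on {0..}"
    by (intro nonnegative_absolutely_integrable_1 integrable_on_exp_minus_to_infinity) auto
  hence "set_integrable lborel {0..} (\<lambda>t. exp (- t) :: real)"
    unfolding set_integrable_def by (subst (asm) integrable_completion) auto
  hence "set_integrable lborel {0..} (\<lambda>t. exp ((b + 1)\<^sup>2 / a) * exp (- t))" by simp
  thus ?thesis
  proof (rule set_integrable_bound)
    show "AE t in lborel. t \<in> {0..} \<longrightarrow> norm (exp (b * t - a * cosh t))
        \<le> norm (exp ((b + 1)\<^sup>2 / a) * exp (- t))"
    proof (intro AE_I2 impI)
      fix t :: real assume "t \<in> {0..}"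
      hence "a * (t\<^sup>2 / 4) \<le> a * cosh t" using a cosh_ge_quadratic by (intro mult_left_mono) auto
      moreover have "0 \<le> ((b + 1) - a * t / 2)\<^sup>2 / a" using a by simp
      hence "(b + 1) * t - a * t\<^sup>2 / 4 \<le> (b + 1)\<^sup>2 / a"
        using a by (simp add: power2_eq_square field_simps)
      ultimately have "b * t - a * cosh t \<le> (b + 1)\<^sup>2 / a + - t" by (simp add: algebra_simps)
      thus "norm (exp (b * t - a * cosh t)) \<le> norm (exp ((b + 1)\<^sup>2 / a) * exp (- t))"
        by (simp flip: exp_add)
    qed
    show "set_borel_measurable lborel {0..} (\<lambda>t. exp (b * t - a * cosh t))"
      unfolding set_borel_measurable_def cosh_def by measurable
  qed
qed

context
  fixes s :: complex
begin

definition bessel_integrand :: "real \<Rightarrow> real \<Rightarrow> complex" where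
  "bessel_integrand y t = of_real (exp (- y * cosh t)) * cosh (s * of_real t)"

text \<open>By \<open>|cosh (s t)| \<le> exp (|s| t)\<close> it dominates the integrand for every complex order \<open>s\<close>, hence
  for every spectral parameter of a Maass form.\<close>

definition bessel_majorant :: "real \<Rightarrow> real \<Rightarrow> real" where
  "bessel_majorant y t = exp (norm s * t - y * cosh t)"

definition bessel_majorant_integral :: "real \<Rightarrow> real" where
  "bessel_majorant_integral y = (LBINT t:{0..}. bessel_majorant y t)"

lemma bessel_majorant_integrable: "y > 0 \<Longrightarrow> set_integrable lborel {0..} (bessel_majorant y)"
  unfolding bessel_majorant_def by (rule exp_cosh_set_integrable)

lemma norm_cosh_le:
  assumes "t \<ge> 0" shows "norm (cosh (s * of_real t)) \<le> exp (norm s * t)"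
proof -
  have "norm (exp (s * of_real t) + exp (- (s * of_real t))) \<le> exp (norm s * t) + exp (norm s * t)"
    using assms norm_exp[of "s * of_real t"] norm_exp[of "- (s * of_real t)"]
    by (intro order.trans[OF norm_triangle_ineq] add_mono) (auto simp: norm_mult)
  thus ?thesis by (simp add: cosh_def scaleR_conv_of_real norm_mult)
qed

lemma norm_bessel_integrand_le: "t \<ge> 0 \<Longrightarrow> norm (bessel_integrand y t) \<le> bessel_majorant y t"
  using mult_left_mono[OF norm_cosh_le[of t], of "exp (- y * cosh t)"]
  by (simp add: bessel_integrand_def bessel_majorant_def norm_mult flip: exp_add)

lemma bessel_integrand_integrable:
  assumes "y > 0" shows "set_integrable lborel {0..} (bessel_integrand y)"
proof (rule set_integrable_bound[OF bessel_majorant_integrable[OF assms]])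
  show "set_borel_measurable lborel {0..} (bessel_integrand y)"
    unfolding set_borel_measurable_def bessel_integrand_def cosh_def by measurable
  show "AE t in lborel. t \<in> {0..} \<longrightarrow> norm (bessel_integrand y t) \<le> norm (bessel_majorant y t)"
    using norm_bessel_integrand_le by (auto simp: bessel_majorant_def)
qed

lemma bessel_K_eq: "bessel_K s y = (LBINT t:{0..}. bessel_integrand y t)"
  by (simp add: bessel_K_def bessel_integrand_def)

lemma bessel_majorant_mono_cosh:
  assumes "y \<ge> 1" "t \<ge> t0" "t0 \<ge> 0"
  shows "bessel_majorant y t \<le> exp (- (y - 1) * cosh t0) * bessel_majorant 1 t"
proof -
  have "(y - 1) * cosh t0 \<le> (y - 1) * cosh t"
    using assms by (intro mult_left_mono) (auto simp: cosh_real_nonneg_le_iff)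
  thus ?thesis by (simp add: bessel_majorant_def algebra_simps flip: exp_add)
qed

lemma norm_bessel_K_le:
  assumes "y \<ge> 1" shows "norm (bessel_K s y) \<le> exp 1 * bessel_majorant_integral 1 * exp (- y)"
proof -
  have "norm (bessel_K s y) \<le> (LBINT t:{0..}. norm (bessel_integrand y t))"
    unfolding bessel_K_eq
      using assms by (intro set_integral_norm_bound bessel_integrand_integrable) auto
  also have "\<dots> \<le> (LBINT t:{0..}. exp (- (y - 1)) * bessel_majorant 1 t)"
  proof (rule set_integral_mono)
    fix t :: real assume "t \<in> {0..}"
    thus "norm (bessel_integrand y t) \<le> exp (- (y - 1)) * bessel_majorant 1 t"
      using norm_bessel_integrand_le[of t y] bessel_majorant_mono_cosh[of y 0 t] assms by simp
  qed (use assms bessel_integrand_integrable bessel_majorant_integrable in \<open>auto intro: set_integrable_norm\<close>)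
  also have "\<dots> = exp 1 * bessel_majorant_integral 1 * exp (- y)"
    by (simp add: bessel_majorant_integral_def exp_diff exp_minus field_simps)
  finally show ?thesis .
qed

text \<open>The integrand is Lipschitz in the argument with constant \<open>cosh t exp (-a cosh t)\<close>, and half of
  the exponential pays for the factor \<open>cosh t\<close>.\<close>

lemma bessel_K_lipschitz:
  assumes a: "a > 0" and uv: "u \<ge> a" "v \<ge> a"
  shows "norm (bessel_K s u - bessel_K s v) \<le> (bessel_majorant_integral (a / 2) / a) * \<bar>u - v\<bar>"
proof -
  have pos: "u > 0" "v > 0" using assms by auto
  note int = bessel_integrand_integrable[OF pos(1)] bessel_integrand_integrable[OF pos(2)]
  have "norm (bessel_K s u - bessel_K s v)
      = norm (LBINT t:{0..}. bessel_integrand u t - bessel_integrand v t)"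
    unfolding bessel_K_eq by (subst set_integral_diff(2)[OF int]) simp
  also have "\<dots> \<le> (LBINT t:{0..}. norm (bessel_integrand u t - bessel_integrand v t))"
    by (intro set_integral_norm_bound set_integral_diff int)
  also have "\<dots> \<le> (LBINT t:{0..}. (\<bar>u - v\<bar> / a) * bessel_majorant (a / 2) t)"
  proof (rule set_integral_mono)
    fix t :: real assume "t \<in> {0..}"
    hence t: "t \<ge> 0" by simp
    define x where "x = cosh t"
    have x: "x \<ge> 1" by (simp add: x_def cosh_real_ge_1)
    have "norm (exp (- u * x) - exp (- v * x)) \<le> (x * exp (- a * x)) * norm (u - v)"
    proof (rule field_differentiable_bound[of "{a..}" "\<lambda>u. exp (- u * x)"
        "\<lambda>u. - x * exp (- u * x)"])
      fix w assume w: "w \<in> {a..}"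
      show "((\<lambda>u. exp (- u * x)) has_field_derivative - x * exp (- w * x)) (at w within {a..})"
        by (auto intro!: derivative_eq_intros)
      show "norm (- x * exp (- w * x)) \<le> x * exp (- a * x)" using w x by (auto simp: abs_mult)
    qed (use uv in auto)
    also have "x * exp (- a * x) \<le> 1 / a * exp (- (a / 2) * x)"
    proof -
      define r where "r = a * x / 2"
      have "0 \<le> (r - 1)\<^sup>2" by simp
      hence "2 * r \<le> 1 + r + r\<^sup>2 / 2" by (simp add: power2_diff)
      also have "\<dots> \<le> exp r" using a x by (intro exp_lower_Taylor_quadratic) (simp add: r_def)
      finally have "a * x \<le> exp (a * x / 2)" by (simp add: r_def)
      hence "a * x * exp (- a * x) \<le> exp (a * x / 2) * exp (- a * x)"
        by (intro mult_right_mono) auto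
      also have "\<dots> = exp (- (a / 2) * x)" by (simp flip: exp_add)
      finally show ?thesis using a by (simp add: field_simps)
    qed
    finally have *: "norm (exp (- u * x) - exp (- v * x))
        \<le> 1 / a * exp (- (a / 2) * x) * norm (u - v)"
      by (simp add: mult_right_mono)
    have "norm (bessel_integrand u t - bessel_integrand v t)
        = norm (exp (- u * x) - exp (- v * x)) * norm (cosh (s * of_real t))"
      unfolding bessel_integrand_def x_def left_diff_distrib[symmetric] of_real_diff[symmetric] norm_mult norm_of_real by simp
    also have "\<dots> \<le> (1 / a * exp (- (a / 2) * x) * norm (u - v)) * exp (norm s * t)"
      using a t by (intro mult_mono * norm_cosh_le) auto
    also have "\<dots> = (\<bar>u - v\<bar> / a) * bessel_majorant (a / 2) t"
      by (simp add: bessel_majorant_def x_def mult_ac flip: exp_add)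
    finally show "norm (bessel_integrand u t - bessel_integrand v t)
        \<le> (\<bar>u - v\<bar> / a) * bessel_majorant (a / 2) t" .
  qed (use a int bessel_majorant_integrable in \<open>auto intro!: set_integrable_norm set_integral_diff\<close>)
  finally show ?thesis by (simp add: bessel_majorant_integral_def mult.commute)
qed

text \<open>Near \<open>t = 0\<close> the factor \<open>cosh (s t)\<close> has real part at least \<open>1/2\<close>, say up to \<open>t0\<close>. The part
  of the integral up to some \<open>t1 < t0\<close> contributes at least a constant times \<open>exp (-u cosh t1)\<close>
  to the real part; between \<open>t1\<close> and \<open>t0\<close> nothing is lost, and beyond \<open>t0\<close> at most a constant
  times \<open>exp (-u cosh t0)\<close>, which is negligible for large \<open>u\<close>. A choice with \<open>cosh t1 \<le> 2\<close> gives
  the exponent of the bound.\<close>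

lemma bessel_K_lower: "\<exists>c>0. \<exists>u0>0. \<forall>u\<ge>u0. c * exp (- 2 * u) \<le> norm (bessel_K s u)"
proof -
  have "((\<lambda>t::real. Re (cosh (s * of_real t))) \<longlongrightarrow> Re (cosh (s * of_real 0))) (at 0)"
    by (intro tendsto_intros)
  moreover have "((\<lambda>t::real. cosh t) \<longlongrightarrow> cosh 0) (at 0)"
    by (intro tendsto_intros)
  ultimately have "((\<lambda>t::real. Re (cosh (s * of_real t))) \<longlongrightarrow> 1) (at 0)" "(cosh \<longlongrightarrow> (1::real)) (at 0)"
    by auto
  hence "eventually (\<lambda>t::real. Re (cosh (s * of_real t)) > 1/2 \<and> cosh t < 2) (at 0)"
    by (intro eventually_conj order_tendstoD) auto
  then obtain d
    where d: "d > 0" "\<And>t::real. t \<noteq> 0 \<Longrightarrow> \<bar>t\<bar> < d \<Longrightarrow> Re (cosh (s * of_real t)) > 1/2 \<and> cosh t < 2"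
    by (auto simp: eventually_at)
  define t0 where "t0 = d / 2"
  define t1 where "t1 = d / 4"
  have t01: "t1 > 0" "t1 < t0" "t0 > 0" using d by (auto simp: t0_def t1_def)
  have near: "Re (cosh (s * of_real t)) \<ge> 1/2" if "t \<in> {0..t0}" for t
    using d(1) d(2)[of t] that by (cases "t = 0") (auto simp: t0_def)
  have c1: "cosh t1 \<le> 2" using d(1) d(2)[of t1] by (auto simp: t1_def)
  have c01: "cosh t1 < cosh t0" using t01 by (simp add: cosh_real_nonneg_less_iff)
  define M where "M = bessel_majorant_integral 1"
  have M: "M \<ge> 0" unfolding M_def bessel_majorant_integral_def set_lebesgue_integral_def
    by (intro integral_nonneg_AE) (auto simp: bessel_majorant_def indicator_def)
  have main: "t1 / 2 * exp (- y * cosh t1) - exp (- (y - 1) * cosh t0) * M \<le> Re (bessel_K s y)"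
    if y: "y \<ge> 1" for y
  proof -
    have i1: "set_integrable lborel {0..} (\<lambda>t. (exp (- y * cosh t1) / 2) * indicator {0..t1} t)"
      unfolding set_integrable_def
      by (intro integrable_mult_indicator integrable_mult_right integrable_real_indicator)
         (use t01 in auto)
    have i2: "set_integrable lborel {0..} (\<lambda>t. exp (- (y - 1) * cosh t0) * bessel_majorant 1 t)"
      using bessel_majorant_integrable[of 1] by auto
    have "(LBINT t:{0..}. indicator {0..t1} t) = t1"
    proof -
      have "(\<lambda>t::real. indicator {0..} t *\<^sub>R (indicator {0..t1} t :: real)) = indicator {0..t1}"
        by (auto simp: indicator_def fun_eq_iff)
      thus ?thesis using t01 by (simp add: set_lebesgue_integral_def)
    qed
    hence "t1 / 2 * exp (- y * cosh t1) - exp (- (y - 1) * cosh t0) * M =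
       (LBINT t:{0..}. (exp (- y * cosh t1) / 2) * indicator {0..t1} t) - (LBINT t:{0..}. exp (- (y - 1) * cosh t0) * bessel_majorant 1 t)"
      unfolding set_integral_mult_right by (simp add: M_def bessel_majorant_integral_def)
    also have "\<dots> = (LBINT t:{0..}. (exp (- y * cosh t1) / 2) * indicator {0..t1} t
        - exp (- (y - 1) * cosh t0) * bessel_majorant 1 t)"
      by (rule set_integral_diff(2)[OF i1 i2, symmetric])
    also have "\<dots> \<le> (LBINT t:{0..}. Re (bessel_integrand y t))"
    proof (rule set_integral_mono[OF set_integral_diff(1)[OF i1 i2]])
      show "set_integrable lborel {0..} (\<lambda>t. Re (bessel_integrand y t))"
        using bessel_integrand_integrable[of y] y unfolding set_integrable_def
        by (auto dest: integrable_Re)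
      fix t :: real assume "t \<in> {0..}"
      hence t: "t \<ge> 0" by simp
      have Re: "Re (bessel_integrand y t) = exp (- y * cosh t) * Re (cosh (s * of_real t))"
        by (simp add: bessel_integrand_def)
      have maj: "exp (- (y - 1) * cosh t0) * bessel_majorant 1 t \<ge> 0"
        by (simp add: bessel_majorant_def)
      show "(exp (- y * cosh t1) / 2) * indicator {0..t1} t
            - exp (- (y - 1) * cosh t0) * bessel_majorant 1 t
              \<le> Re (bessel_integrand y t)"
      proof (cases "t \<le> t0")
        case True
        have "exp (- y * cosh t) * (1/2) \<le> Re (bessel_integrand y t)"
          unfolding Re using near[of t] t True by (intro mult_left_mono) auto
        moreover have "(exp (- y * cosh t1) / 2) * indicator {0..t1} t \<le> exp (- y * cosh t) * (1/2)"
          using t y t01 by (auto simp: indicator_def cosh_real_nonneg_le_iff)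
        ultimately show ?thesis using maj by linarith
      next
        case False
        have "- Re (bessel_integrand y t) \<le> norm (bessel_integrand y t)"
          using abs_Re_le_cmod[of "bessel_integrand y t"] by linarith
        also have "\<dots> \<le> exp (- (y - 1) * cosh t0) * bessel_majorant 1 t"
          using norm_bessel_integrand_le[OF t, of y] bessel_majorant_mono_cosh[of y t0 t] y False t01 by simp
        finally show ?thesis using False t01 by simp
      qed
    qed
    also have "\<dots> = Re (bessel_K s y)"
    proof -
      have "integrable lborel (\<lambda>t. indicator {0..} t *\<^sub>R bessel_integrand y t)"
        using bessel_integrand_integrable[of y] y by (simp add: set_integrable_def)
      from integral_Re[OF this] show ?thesis by (simp add: bessel_K_eq set_lebesgue_integral_def)
    qed
    finally show ?thesis .
  qed
  define D where "D = cosh t0 - cosh t1"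
  have D: "D > 0" using c01 by (simp add: D_def)
  \<comment> \<open>\<open>u0\<close> makes the tail at most half of the main part.\<close>
  define u0 where "u0 = max 1 (ln (4 * (M + 1) * exp (cosh t0) / t1) / D)"
  have "t1 / 4 * exp (- 2 * y) \<le> norm (bessel_K s y)" if y: "y \<ge> u0" for y
  proof -
    have y1: "y \<ge> 1" using y by (simp add: u0_def)
    have "ln (4 * (M + 1) * exp (cosh t0) / t1) / D \<le> y" using y by (simp add: u0_def)
    hence "ln (4 * (M + 1) * exp (cosh t0) / t1) \<le> y * D" using D by (simp add: field_simps)
    hence "exp (ln (4 * (M + 1) * exp (cosh t0) / t1)) \<le> exp (y * D)" by simp
    hence "4 * (M + 1) * exp (cosh t0) / t1 \<le> exp (y * D)"
      using M t01 by (subst (asm) exp_ln) auto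
    hence "(M + 1) * exp (cosh t0) \<le> t1 / 4 * exp (y * D)" using t01 by (simp add: field_simps)
    hence "(M + 1) * exp (cosh t0) * exp (- y * cosh t0)
        \<le> t1 / 4 * exp (y * D) * exp (- y * cosh t0)"
      by (intro mult_right_mono) auto
    also have "\<dots> = t1 / 4 * exp (- y * cosh t1)" by (simp add: D_def algebra_simps flip: exp_add)
    also have "(M + 1) * exp (cosh t0) * exp (- y * cosh t0) = (M + 1) * exp (- (y - 1) * cosh t0)"
      by (simp add: algebra_simps flip: exp_add)
    finally have "exp (- (y - 1) * cosh t0) * M \<le> t1 / 4 * exp (- y * cosh t1)"
      by (simp add: ring_distribs) (smt (verit) exp_gt_zero mult.commute)
    with main[OF y1] have "t1 / 4 * exp (- y * cosh t1) \<le> Re (bessel_K s y)" by simp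
    moreover have "t1 / 4 * exp (- 2 * y) \<le> t1 / 4 * exp (- y * cosh t1)"
      using t01 c1 y1 by (intro mult_left_mono) auto
    moreover have "Re (bessel_K s y) \<le> norm (bessel_K s y)" by (rule complex_Re_le_cmod)
    ultimately show ?thesis by linarith
  qed
  moreover have "u0 > 0" by (simp add: u0_def)
  ultimately show ?thesis using t01 by (intro exI[of _ "t1 / 4"] conjI exI[of _ u0]) auto
qed

end

lemma maass_whittaker_expansion:
  assumes "maass_cusp_form \<nu> f" "maass_fourier_coeffs \<nu> f A"
  shows "whittaker_expansion f A (\<lambda>u. 2 * bessel_K (\<i> * \<nu>) u) (- {0})"
proof
  let ?K = "bessel_K (\<i> * \<nu>)"
  show "{1..} \<subseteq> - {0::int}" "(0::int) \<notin> - {0}" by auto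
  show "norm (f ((of_int a * z + of_int b) / (of_int c * z + of_int d))) = norm (f z)"
    if "a * d - b * c = 1" "Im z > 0" for a b c d z
    using assms(1) that
      by (auto simp: maass_cusp_form_def modular_invariant_def upper_half_plane_def)
  show "((\<lambda>n. of_real (sqrt y) * A n * (2 * ?K (2 * pi * \<bar>of_int n\<bar> * y)) * fourier_char n x)
          has_sum f (Complex x y)) (- {0})" if y: "y > 0" for x y
  proof -
    have "e2pi (of_int n * of_real x) = fourier_char n x" for n
      by (simp add: e2pi_def cis_conv_exp mult_ac)
    moreover have "((\<lambda>n. 2 * of_real (sqrt y) * A n * ?K (2 * pi * \<bar>of_int n\<bar> * y)
        * e2pi (of_int n * of_real x))
           has_sum f (Complex x y)) (- {0})"
      using assms(2) y by (simp add: maass_fourier_coeffs_def)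
    ultimately show ?thesis by (simp add: mult_ac)
  qed
  show "\<exists>C. \<forall>u\<ge>1. norm (2 * ?K u) \<le> C * exp (- u / 2)"
  proof (intro exI allI impI)
    fix u :: real assume u: "u \<ge> 1"
    define C where "C = exp 1 * bessel_majorant_integral (\<i> * \<nu>) 1"
    have "norm (?K u) \<le> C * exp (- u)" unfolding C_def by (rule norm_bessel_K_le[OF u])
    moreover have "0 \<le> C * exp (- u)" using calculation norm_ge_zero order.trans by blast
    hence "C * exp (- u) \<le> C * exp (- u / 2)"
      using u by (intro mult_left_mono) (auto simp: zero_le_mult_iff)
    ultimately have "norm (2 * ?K u) \<le> (2 * C) * exp (- u / 2)" by (simp add: norm_mult)
    thus "norm (2 * ?K u) \<le> (2 * (exp 1 * bessel_majorant_integral (\<i> * \<nu>) 1)) * exp (- u / 2)"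
      unfolding C_def .
  qed
  obtain c u0 where "c > 0" "u0 > 0" "\<forall>u\<ge>u0. c * exp (- 2 * u) \<le> norm (?K u)"
    using bessel_K_lower[of "\<i> * \<nu>"] by blast
  moreover have "norm (?K u) \<le> norm (2 * ?K u)" for u by (simp add: norm_mult)
  ultimately show "\<exists>c>0. \<exists>u0>0. \<forall>u\<ge>u0. c * exp (- 2 * u) \<le> norm (2 * ?K u)"
    using order.trans by blast
  show "\<exists>L. \<forall>u\<in>{a..b}. \<forall>v\<in>{a..b}. norm (2 * ?K u - 2 * ?K v) \<le> L * \<bar>u - v\<bar>" if a: "0 < a" for a b
  proof (intro exI ballI)
    fix u v assume "u \<in> {a..b}" "v \<in> {a..b}"
    hence "norm (?K u - ?K v) \<le> (bessel_majorant_integral (\<i> * \<nu>) (a / 2) / a) * \<bar>u - v\<bar>"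
      using a by (intro bessel_K_lipschitz) auto
    moreover have "norm (2 * ?K u - 2 * ?K v) = 2 * norm (?K u - ?K v)"
      unfolding right_diff_distrib[symmetric] norm_mult by simp
    ultimately show "norm (2 * ?K u - 2 * ?K v)
        \<le> (2 * (bessel_majorant_integral (\<i> * \<nu>) (a / 2) / a)) * \<bar>u - v\<bar>"
      by simp
  qed
qed

section \<open>Second moment of the number of representations as sums of squares\<close>

text \<open>The divisor problem in its crudest form: for each \<open>a\<close> there are at most \<open>2 T / |a|\<close> values of
  \<open>g\<close>, and the sum over \<open>a\<close> is harmonic.\<close>

lemma card_product_box_le:
  fixes T :: nat
  defines "Z \<equiv> {(g::int, a::int). g * a \<noteq> 0 \<and> \<bar>g * a\<bar> \<le> int T}"
  shows "finite Z" "real (card Z) \<le> 4 * real T * (1 + ln (1 + real T))"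
proof -
  define I where "I a = {-(int T div \<bar>a\<bar>)..int T div \<bar>a\<bar>} - {0}" for a :: int
  have sub: "Z \<subseteq> (\<lambda>(a, g). (g, a)) ` (SIGMA a:{-int T..int T} - {0}. I a)"
  proof safe
    fix g a assume ga: "(g, a) \<in> Z"
    have 0: "g \<noteq> 0" "a \<noteq> 0" "\<bar>g\<bar> * \<bar>a\<bar> \<le> int T" using ga by (auto simp: Z_def abs_mult)
    have "\<bar>a\<bar> \<le> \<bar>g\<bar> * \<bar>a\<bar>" using mult_right_mono[of 1 "\<bar>g\<bar>" "\<bar>a\<bar>"] 0 by simp
    with 0 have "\<bar>a\<bar> \<le> int T" by linarith
    moreover have "\<bar>g\<bar> \<le> int T div \<bar>a\<bar>" using zdiv_mono1[OF 0(3), of "\<bar>a\<bar>"] 0 by simp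
    ultimately show "(g, a) \<in> (\<lambda>(a, g). (g, a)) ` (SIGMA a:{-int T..int T} - {0}. I a)"
      using 0 by (auto simp: I_def image_iff)
  qed
  have fin: "finite (SIGMA a:{-int T..int T} - {0}. I a)" by (auto simp: I_def)
  show "finite Z" by (rule finite_subset[OF sub]) (use fin in simp)
  have cardI: "real (card (I a)) \<le> 2 * real T / real_of_int \<bar>a\<bar>" if "a \<noteq> 0" for a
  proof -
    define q where "q = int T div \<bar>a\<bar>"
    have q: "q \<ge> 0" by (simp add: q_def div_int_pos_iff)
    have "card (I a) = card {-q..q} - 1"
      unfolding I_def q_def[symmetric] using q by (subst card_Diff_singleton) auto
    also have "\<dots> = nat (2 * q)" using q by simp
    finally have "real (card (I a)) = 2 * real_of_int q" using q by simp
    also have "real_of_int q \<le> real_of_int (int T) / real_of_int \<bar>a\<bar>"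
      unfolding q_def by (rule real_of_int_div4)
    finally show ?thesis by simp
  qed
  have "card Z \<le> card (SIGMA a:{-int T..int T} - {0}. I a)"
    by (rule order.trans[OF card_mono[OF _ sub] card_image_le]) (use fin in auto)
  also have "\<dots> = (\<Sum>a\<in>{-int T..int T} - {0}. card (I a))" by (rule card_SigmaI) (auto simp: I_def)
  finally have "real (card Z) \<le> (\<Sum>a\<in>{-int T..int T} - {0}. real (card (I a)))"
    by (simp flip: of_nat_sum)
  also have "\<dots> \<le> (\<Sum>a\<in>{-int T..int T} - {0}. 2 * real T / real_of_int \<bar>a\<bar>)"
    by (intro sum_mono cardI) auto
  also have "{-int T..int T} - {0} = int ` {1..T} \<union> (\<lambda>n. - int n) ` {1..T}"
  proof (intro equalityI subsetI)
    fix n assume "n \<in> {-int T..int T} - {0}"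
    thus "n \<in> int ` {1..T} \<union> (\<lambda>n. - int n) ` {1..T}"
      by (cases n rule: int_cases2) auto
  qed auto
  also have "(\<Sum>a\<in>\<dots>. 2 * real T / real_of_int \<bar>a\<bar>) =
      (\<Sum>n=1..T. 2 * real T / real n) + (\<Sum>n=1..T. 2 * real T / real n)"
    by (subst sum.union_disjoint) (auto simp: sum.reindex inj_on_def)
  also have "\<dots> = 4 * real T * harm T" by (simp add: harm_def sum_distrib_left field_simps)
  also have "harm T \<le> 1 + ln (1 + real T)"
  proof (cases "T = 0")
    case False
    then obtain m where m: "T = Suc m" by (cases T) auto
    have "harm T - ln (real T) \<le> (1::real)"
      using euler_mascheroni_sequence_decreasing[of 1 T] m by (simp add: harm_expand)
    moreover have "ln (real T) \<le> ln (1 + real T)" using False by simp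
    ultimately show ?thesis by linarith
  qed (simp add: harm_expand)
  hence "4 * real T * harm T \<le> 4 * real T * (1 + ln (1 + real T))" by (intro mult_left_mono) auto
  finally show "real (card Z) \<le> 4 * real T * (1 + ln (1 + real T))" .
qed

text \<open>A solution of \<open>p q = r s \<noteq> 0\<close> factors as \<open>p = g a\<close>, \<open>q = b t\<close>, \<open>r = g b\<close>, \<open>s = a t\<close> with
  \<open>g = gcd p r\<close>. It is thus given by two pairs \<open>(g, a)\<close> and \<open>(b, t)\<close> whose products are at most
  \<open>T\<close> in absolute value. The solutions with both products zero are counted trivially.\<close>

lemma card_multiplicative_energy_le:
  fixes T :: nat
  assumes "T \<ge> 1"
  defines "B \<equiv> {-int T..int T}"
  shows "real (card {(x, y) \<in> (B \<times> B) \<times> (B \<times> B). fst x * snd x = fst y * snd y})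
           \<le> 52 * (real T)\<^sup>2 * (1 + ln (1 + real T))\<^sup>2"
proof -
  define Q where "Q = {(x, y) \<in> (B \<times> B) \<times> (B \<times> B). fst x * snd x = fst y * snd y}"
  define Z where "Z = {(g::int, a::int). g * a \<noteq> 0 \<and> \<bar>g * a\<bar> \<le> int T}"
  define Z0 where "Z0 = {0} \<times> B \<union> B \<times> {0}"
  have finB: "finite B" and cardB: "card B \<le> 3 * T" using assms by (auto simp: B_def)
  have finZ0: "finite Z0" by (simp add: Z0_def finB)
  have "card Z0 \<le> card B + card B"
    unfolding Z0_def by (rule order.trans[OF card_Un_le]) (simp add: card_cartesian_product)
  hence cardZ0: "card Z0 \<le> 6 * T" using cardB by simp
  note Z = card_product_box_le[of T, folded Z_def]
  define F where "F = (\<lambda>((g::int, a::int), (b::int, t::int)). ((g * a, b * t), (g * b, a * t)))"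
  have "Q \<subseteq> (Z0 \<times> Z0) \<union> F ` (Z \<times> Z)"
  proof
    fix x assume x: "x \<in> Q"
    then obtain p q r s where x_eq: "x = ((p, q), (r, s))" and
      *: "p \<in> B" "q \<in> B" "r \<in> B" "s \<in> B" "p * q = r * s" by (auto simp: Q_def B_def)
    show "x \<in> (Z0 \<times> Z0) \<union> F ` (Z \<times> Z)"
    proof (cases "p * q = 0")
      case True
      hence "(p, q) \<in> Z0" "(r, s) \<in> Z0" using * by (auto simp: Z0_def)
      thus ?thesis by (simp add: x_eq)
    next
      case False
      define g where "g = gcd p r"
      have g: "g \<noteq> 0" using False by (auto simp: g_def)
      obtain a b where ab: "p = g * a" "r = g * b" "coprime a b"
        using gcd_coprime_exists[of p r] g unfolding g_def by (metis mult.commute)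
      have eq: "a * q = b * s" using *(5) g unfolding ab by (simp add: mult.assoc)
      hence "b dvd a * q" by simp
      hence "b dvd q" using ab(3) by (simp add: coprime_dvd_mult_right_iff coprime_commute)
      then obtain t where t: "q = b * t" by auto
      have b0: "b \<noteq> 0" using False *(5) ab by auto
      have "s = a * t" using eq b0 unfolding t by (simp add: mult.left_commute)
      moreover have "(g, a) \<in> Z" "(b, t) \<in> Z" using * False ab t by (auto simp: Z_def B_def)
      ultimately have "x = F ((g, a), (b, t))" "((g, a), (b, t)) \<in> Z \<times> Z"
        by (auto simp: F_def x_eq ab t)
      thus ?thesis by blast
    qed
  qed
  hence "card Q \<le> card ((Z0 \<times> Z0) \<union> F ` (Z \<times> Z))"
    by (intro card_mono) (auto simp: finZ0 Z)
  also have "\<dots> \<le> card (Z0 \<times> Z0) + card (Z \<times> Z)"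
    by (intro order.trans[OF card_Un_le] add_mono card_image_le) (auto simp: finZ0 Z)
  also have "\<dots> = (card Z0)\<^sup>2 + (card Z)\<^sup>2" by (simp add: card_cartesian_product power2_eq_square)
  finally have "real (card Q) \<le> (real (card Z0))\<^sup>2 + (real (card Z))\<^sup>2"
    by (metis of_nat_add of_nat_le_iff of_nat_power)
  also have "\<dots> \<le> (6 * real T)\<^sup>2 + (4 * real T * (1 + ln (1 + real T)))\<^sup>2"
    using cardZ0 Z by (intro add_mono power_mono) auto
  also have "\<dots> = (real T)\<^sup>2 * (36 * 1\<^sup>2 + 16 * (1 + ln (1 + real T))\<^sup>2)"
    by (simp only: power_mult_distrib) (simp add: algebra_simps)
  also have "\<dots> \<le> (real T)\<^sup>2 * (36 * (1 + ln (1 + real T))\<^sup>2 + 16 * (1 + ln (1 + real T))\<^sup>2)"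
    by (intro mult_left_mono add_right_mono power_mono) auto
  finally show ?thesis by (simp add: Q_def algebra_simps)
qed

lemma finite_square_lists:
  "finite {v :: int list. length v = l \<and> set v \<subseteq> {-int R..int R}}"
  "card {v :: int list. length v = l \<and> set v \<subseteq> {-int R..int R}} = (2 * R + 1) ^ l"
proof -
  have "finite {xs. set xs \<subseteq> {-int R..int R} \<and> length xs = l}" by (rule finite_lists_length_eq) simp
  thus "finite {v :: int list. length v = l \<and> set v \<subseteq> {-int R..int R}}" by (simp add: conj_commute)
  have "card {xs. set xs \<subseteq> {-int R..int R} \<and> length xs = l} = card {-int R..int R} ^ l"
    by (rule card_lists_length_eq) simp
  thus "card {v :: int list. length v = l \<and> set v \<subseteq> {-int R..int R}} = (2 * R + 1) ^ l"
    by (simp add: conj_commute nat_add_distrib nat_mult_distrib)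
qed

lemma set_subset_of_sum_squares_le:
  fixes v :: "int list"
  assumes "(\<Sum>k\<leftarrow>v. k\<^sup>2) \<le> int N" "N < (R + 1)\<^sup>2"
  shows "set v \<subseteq> {-int R..int R}"
proof
  fix k assume k: "k \<in> set v"
  have "k\<^sup>2 \<le> (\<Sum>k\<leftarrow>v. k\<^sup>2)" using k by (intro member_le_sum_list) auto
  also have "\<dots> \<le> int N" by (rule assms)
  also have "\<dots> < int ((R + 1)\<^sup>2)" using assms(2) by (simp only: of_nat_less_iff)
  finally have "\<bar>k\<bar>\<^sup>2 < (int R + 1)\<^sup>2" by (simp add: add.commute)
  hence "\<bar>k\<bar> < int R + 1" by (rule power2_less_imp_less) simp
  thus "k \<in> {-int R..int R}" by auto
qed

text \<open>With \<open>\<rho>(k)\<close> the number of \<open>x\<close> with \<open>m x = k\<close>, the left side is the sum of \<open>\<rho>(k) \<rho>(h - k)\<close>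
  and the right side that of \<open>\<rho>(k)\<^sup>2\<close>; compare them by \<open>2 \<rho>(k) \<rho>(h - k) \<le> \<rho>(k)\<^sup>2 + \<rho>(h - k)\<^sup>2\<close>.\<close>

lemma card_sum_eq_le_additive_energy:
  fixes m :: "'a \<Rightarrow> int"
  assumes P: "finite P"
  shows "card {(x, y) \<in> P \<times> P. m x + m y = h} \<le> card {(x, y) \<in> P \<times> P. m x = m y}"
proof -
  define f where "f k = {x \<in> P. m x = k}" for k
  define K where "K = m ` P"
  have fin: "finite (f k)" "finite K" for k using P by (auto simp: f_def K_def)
  have off: "f k = {}" if "k \<notin> K" for k using that by (auto simp: f_def K_def)
  have "{(x, y) \<in> P \<times> P. m x + m y = h} = (\<Union>k\<in>K. f k \<times> f (h - k))"
    by (auto simp: f_def K_def)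
  hence "card {(x, y) \<in> P \<times> P. m x + m y = h} \<le> (\<Sum>k\<in>K. card (f k \<times> f (h - k)))"
    using card_UN_le[OF fin(2)] by metis
  hence "2 * real (card {(x, y) \<in> P \<times> P. m x + m y = h})
      \<le> (\<Sum>k\<in>K. 2 * (real (card (f k)) * real (card (f (h - k)))))"
    unfolding sum_distrib_left[symmetric] card_cartesian_product
    by (simp flip: of_nat_mult of_nat_sum)
  also have "\<dots> \<le> (\<Sum>k\<in>K. (real (card (f k)))\<^sup>2 + (real (card (f (h - k))))\<^sup>2)"
    using sum_squares_bound by (intro sum_mono) (simp add: mult.assoc)
  also have "\<dots> = (\<Sum>k\<in>K. (real (card (f k)))\<^sup>2) + (\<Sum>k\<in>(\<lambda>k. h - k) ` K. (real (card (f k)))\<^sup>2)"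
    by (subst sum.reindex) (auto simp: inj_on_def sum.distrib)
  also have "(\<Sum>k\<in>(\<lambda>k. h - k) ` K. (real (card (f k)))\<^sup>2) =
             (\<Sum>k\<in>(\<lambda>k. h - k) ` K \<inter> K. (real (card (f k)))\<^sup>2)"
    by (rule sum.mono_neutral_right) (use fin off in auto)
  also have "\<dots> \<le> (\<Sum>k\<in>K. (real (card (f k)))\<^sup>2)"
    by (rule sum_mono2) (use fin in auto)
  also have "(\<Sum>k\<in>K. (real (card (f k)))\<^sup>2) = (\<Sum>k\<in>K. real (card (f k \<times> f k)))"
    by (simp add: card_cartesian_product power2_eq_square)
  also have "\<dots> = real (card (\<Union>k\<in>K. f k \<times> f k))"
    by (subst card_UN_disjoint) (use fin in \<open>auto simp: f_def\<close>)
  also have "(\<Union>k\<in>K. f k \<times> f k) = {(x, y) \<in> P \<times> P. m x = m y}"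
    by (auto simp: f_def K_def)
  finally show ?thesis by simp
qed

text \<open>Fix all coordinates of \<open>v\<close> and \<open>w\<close> except the first two of each, say \<open>a, b\<close> and \<open>c, d\<close>.
  The condition becomes \<open>(a - c) (a + c) + (b - d) (b + d) = h\<close> for a fixed \<open>h\<close>, and the number of
  its solutions is at most the multiplicative energy of an interval of radius \<open>2 R\<close>.\<close>

lemma card_eq_sum_squares_pairs_le:
  fixes R l :: nat
  assumes "R \<ge> 1"
  defines "V \<equiv> \<lambda>l. {v :: int list. length v = l \<and> set v \<subseteq> {-int R..int R}}"
  shows "real (card {(v, w) \<in> V (l + 2) \<times> V (l + 2). (\<Sum>k\<leftarrow>v. k\<^sup>2) = (\<Sum>k\<leftarrow>w. k\<^sup>2)})
    \<le> (2 * real R + 1) ^ (2 * l) * (208 * (real R)\<^sup>2 * (1 + ln (1 + 2 * real R))\<^sup>2)"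
proof -
  define S where "S = {(v, w) \<in> V (l + 2) \<times> V (l + 2). (\<Sum>k\<leftarrow>v. k\<^sup>2) = (\<Sum>k\<leftarrow>w. k\<^sup>2)}"
  define T where "T = 2 * R"
  define B where "B = {-int T..int T}"
  define P where "P = B \<times> B"
  define E where "E h = {(x, y) \<in> P \<times> P. fst x * snd x + fst y * snd y = h}" for h :: int
  define sq where "sq v = (\<Sum>k\<leftarrow>v. k\<^sup>2)" for v :: "int list"
  define \<phi> where "\<phi> = (\<lambda>(v :: int list, w). ((drop 2 v, drop 2 w),
      ((v ! 0 - w ! 0, v ! 0 + w ! 0), (v ! 1 - w ! 1, v ! 1 + w ! 1))))"
  have finV: "finite (V l)" for l unfolding V_def by (rule finite_square_lists)
  have finP: "finite P" by (simp add: P_def B_def)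
  have finE: "finite (E h)" for h
    by (rule finite_subset[of _ "P \<times> P"]) (auto simp: E_def finP)
  have split: "\<exists>a b v'. v = a # b # v' \<and> a \<in> {-int R..int R} \<and> b \<in> {-int R..int R} \<and> v' \<in> V l"
    if "v \<in> V (l + 2)" for v
    using that by (cases v; cases "tl v") (auto simp: V_def)
  have "inj_on \<phi> S"
  proof (rule inj_onI)
    fix x y assume xy: "x \<in> S" "y \<in> S" "\<phi> x = \<phi> y"
    obtain v w v' w' where vw: "x = (v, w)" "y = (v', w')" by (cases x; cases y)
    have "v \<in> V (l + 2)" "w \<in> V (l + 2)" "v' \<in> V (l + 2)" "w' \<in> V (l + 2)"
      using xy(1,2) by (auto simp: S_def vw)
    from this[THEN split] show "x = y" using xy(3) by (auto simp: \<phi>_def vw)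
  qed
  moreover have "\<phi> ` S \<subseteq> (SIGMA u:V l \<times> V l. E (sq (snd u) - sq (fst u)))"
  proof
    fix y assume "y \<in> \<phi> ` S"
    then obtain v w where vw: "y = \<phi> (v, w)" "(v, w) \<in> S" by auto
    hence V: "v \<in> V (l + 2)" "w \<in> V (l + 2)" by (auto simp: S_def)
    obtain a b v' where v: "v = a # b # v'" "a \<in> {-int R..int R}" "b \<in> {-int R..int R}" "v' \<in> V l"
      using split[OF V(1)] by blast
    obtain c d w' where w: "w = c # d # w'" "c \<in> {-int R..int R}" "d \<in> {-int R..int R}" "w' \<in> V l"
      using split[OF V(2)] by blast
    have "sq v = sq w" using vw(2) by (simp add: S_def sq_def)
    hence "(a - c) * (a + c) + (b - d) * (b + d) = sq w' - sq v'"
      by (simp add: v w sq_def power2_eq_square algebra_simps)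
    thus "y \<in> (SIGMA u:V l \<times> V l. E (sq (snd u) - sq (fst u)))"
      using v w by (auto simp: vw(1) \<phi>_def E_def P_def B_def T_def)
  qed
  ultimately have "card S \<le> card (SIGMA u:V l \<times> V l. E (sq (snd u) - sq (fst u)))"
    by (intro card_inj_on_le[of \<phi>]) (auto simp: finV finE)
  also have "\<dots> = (\<Sum>u\<in>V l \<times> V l. card (E (sq (snd u) - sq (fst u))))"
    by (rule card_SigmaI) (auto simp: finV finE)
  finally have "real (card S) \<le> (\<Sum>u\<in>V l \<times> V l. real (card (E (sq (snd u) - sq (fst u)))))"
    by (simp flip: of_nat_sum)
  also have "\<dots> \<le> (\<Sum>u\<in>V l \<times> V l. 52 * (real T)\<^sup>2 * (1 + ln (1 + real T))\<^sup>2)"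
  proof (rule sum_mono)
    fix u
    have "card (E (sq (snd u) - sq (fst u))) \<le> card {(x, y) \<in> P \<times> P. fst x * snd x = fst y * snd y}"
      unfolding E_def by (rule card_sum_eq_le_additive_energy[OF finP])
    also have "real \<dots> \<le> 52 * (real T)\<^sup>2 * (1 + ln (1 + real T))\<^sup>2"
      unfolding P_def B_def
        by (rule card_multiplicative_energy_le) (use assms(1) in \<open>simp add: T_def\<close>)
    finally show "real (card (E (sq (snd u) - sq (fst u))))
        \<le> 52 * (real T)\<^sup>2 * (1 + ln (1 + real T))\<^sup>2"
      by simp
  qed
  also have "\<dots> = real (card (V l) * card (V l)) * (52 * (real T)\<^sup>2 * (1 + ln (1 + real T))\<^sup>2)"
    by (simp add: card_cartesian_product)
  also have "real (card (V l) * card (V l)) = (2 * real R + 1) ^ (2 * l)"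
  proof -
    have "card (V l) = (2 * R + 1) ^ l" unfolding V_def by (rule finite_square_lists)
    hence "real (card (V l)) = (2 * real R + 1) ^ l" by (simp add: add.commute)
    thus ?thesis by (simp only: of_nat_mult mult_2 power_add)
  qed
  finally show ?thesis by (simp add: S_def T_def power_mult_distrib)
qed

lemma lattice_box_radius:
  assumes "N \<ge> 1"
  obtains R where "R \<ge> 1" "N < (R + 1)\<^sup>2" "real R \<le> sqrt (real N)"
proof -
  define R where "R = nat \<lfloor>sqrt (real N)\<rfloor>"
  have s: "sqrt (real N) \<ge> 1" using assms by simp
  have R: "real R \<le> sqrt (real N)" "sqrt (real N) < real R + 1" "R \<ge> 1"
    unfolding R_def using s by linarith+
  have "real N = (sqrt (real N))\<^sup>2" by simp
  also have "\<dots> < (real R + 1)\<^sup>2" using R s by (intro power_strict_mono) auto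
  also have "\<dots> = real ((R + 1)\<^sup>2)" by simp
  finally show ?thesis using that R by (simp only: of_nat_less_iff)
qed

lemma representations_subset_box:
  assumes "n \<le> N" "N < (R + 1)\<^sup>2"
  shows "{v :: int list. length v = l \<and> (\<Sum>k\<leftarrow>v. k\<^sup>2) = int n}
           \<subseteq> {v. length v = l \<and> set v \<subseteq> {-int R..int R}}"
proof safe
  fix v :: "int list" and k
  assume v: "(\<Sum>k\<leftarrow>v. k\<^sup>2) = int n" and k: "k \<in> set v"
  show "k \<in> {-int R..int R}"
    by (rule subsetD[OF set_subset_of_sum_squares_le[OF _ assms(2)] k]) (use v assms(1) in simp)
qed

lemma sum_r_squares_le:
  "(\<Sum>n=1..N. real (r_squares l n)) \<le> 3 ^ l * sqrt (real N) ^ l"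
proof (cases "N = 0")
  case False
  then obtain R where R: "R \<ge> 1" "N < (R + 1)\<^sup>2" "real R \<le> sqrt (real N)"
    using lattice_box_radius[of N] by auto
  define S where "S n = {v :: int list. length v = l \<and> (\<Sum>k\<leftarrow>v. k\<^sup>2) = int n}" for n
  define V where "V = {v :: int list. length v = l \<and> set v \<subseteq> {-int R..int R}}"
  have V: "finite V" "card V = (2 * R + 1) ^ l" unfolding V_def by (rule finite_square_lists)+
  have sub: "S n \<subseteq> V" if "n \<in> {1..N}" for n
    unfolding S_def V_def using that R by (intro representations_subset_box[of n N]) auto
  have "(\<Sum>n=1..N. r_squares l n) = (\<Sum>n=1..N. card (S n))"
    by (simp add: r_squares_def S_def)
  also have "\<dots> = card (\<Union>n\<in>{1..N}. S n)"
  proof (subst card_UN_disjoint)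
    show "\<forall>n\<in>{1..N}. finite (S n)" using sub V(1) finite_subset by blast
  qed (auto simp: S_def)
  also have "\<dots> \<le> card V" by (intro card_mono UN_least sub V)
  finally have "(\<Sum>n=1..N. r_squares l n) \<le> (2 * R + 1) ^ l" by (simp add: V)
  hence "(\<Sum>n=1..N. real (r_squares l n)) \<le> (2 * real R + 1) ^ l"
    using of_nat_mono[of "\<Sum>n=1..N. r_squares l n" "(2 * R + 1) ^ l",
      where ?'a = real] by (simp add: add.commute)
  also have "\<dots> \<le> (3 * sqrt (real N)) ^ l" using R by (intro power_mono) auto
  finally show ?thesis by (simp add: power_mult_distrib)
qed simp

text \<open>The second moment counts pairs of lattice points on a common sphere. Up to a logarithm it has
  the size that \<open>r\<^sub>l(n)\<close> would give if it were of order \<open>n\<^bsup>l/2-1\<^esup>\<close> for each single \<open>n\<close>.\<close>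

lemma sum_r_squares_power2_le:
  assumes "l \<ge> 2"
  shows "(\<Sum>n=1..N. (real (r_squares l n))\<^sup>2)
           \<le> 208 * 9 ^ (l - 2) * real N ^ (l - 1) * (1 + ln (1 + 2 * sqrt (real N)))\<^sup>2"
proof (cases "N = 0")
  case False
  then obtain R where R: "R \<ge> 1" "N < (R + 1)\<^sup>2" "real R \<le> sqrt (real N)"
    using lattice_box_radius[of N] by auto
  define S where "S n = {v :: int list. length v = l \<and> (\<Sum>k\<leftarrow>v. k\<^sup>2) = int n}" for n
  define V where "V l = {v :: int list. length v = l \<and> set v \<subseteq> {-int R..int R}}" for l
  define Q where "Q = {(v, w) \<in> V l \<times> V l. (\<Sum>k\<leftarrow>v. k\<^sup>2) = (\<Sum>k\<leftarrow>w. k\<^sup>2)}"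
  have V: "finite (V l)" unfolding V_def by (rule finite_square_lists)
  have Q: "finite Q" by (rule finite_subset[of _ "V l \<times> V l"]) (auto simp: Q_def V)
  have sub: "S n \<subseteq> V l" if "n \<in> {1..N}" for n
    unfolding S_def V_def using that R by (intro representations_subset_box[of n N]) auto
  have "(\<Sum>n=1..N. (r_squares l n)\<^sup>2) = (\<Sum>n=1..N. card (S n \<times> S n))"
    by (simp add: r_squares_def S_def card_cartesian_product power2_eq_square)
  also have "\<dots> = card (\<Union>n\<in>{1..N}. S n \<times> S n)"
  proof (subst card_UN_disjoint)
    show "\<forall>n\<in>{1..N}. finite (S n \<times> S n)" using sub V finite_subset by blast
  qed (auto simp: S_def)
  also have "\<dots> \<le> card Q"
  proof (rule card_mono[OF Q], safe)
    fix n v w assume n: "n \<in> {1..N}" and vw: "v \<in> S n" "w \<in> S n"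
    thus "(v, w) \<in> Q" using sub[OF n] by (auto simp: Q_def S_def)
  qed
  finally have "real (\<Sum>n=1..N. (r_squares l n)\<^sup>2) \<le> real (card Q)" by (rule of_nat_mono)
  hence "(\<Sum>n=1..N. (real (r_squares l n))\<^sup>2) \<le> real (card Q)" by simp
  also have "\<dots> \<le> (2 * real R + 1) ^ (2 * (l - 2)) *
      (208 * (real R)\<^sup>2 * (1 + ln (1 + 2 * real R))\<^sup>2)"
    using card_eq_sum_squares_pairs_le[OF R(1), of "l - 2"]
    unfolding le_add_diff_inverse2[OF assms] by (simp add: Q_def V_def)
  also have "\<dots> \<le> (3 * sqrt (real N)) ^ (2 * (l - 2)) *
      (208 * (sqrt (real N))\<^sup>2 * (1 + ln (1 + 2 * sqrt (real N)))\<^sup>2)"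
    using R by (intro mult_mono power_mono add_mono) auto
  also have "\<dots> = 208 * 9 ^ (l - 2) * (real N ^ (l - 2) * real N) *
      (1 + ln (1 + 2 * sqrt (real N)))\<^sup>2"
    by (simp add: power_mult power_mult_distrib)
  also have "real N ^ (l - 2) * real N = real N ^ (l - 1)"
  proof -
    have "l - 1 = Suc (l - 2)" using assms by simp
    thus ?thesis by simp
  qed
  finally show ?thesis .
qed simp

section \<open>Shifted sums\<close>

text \<open>The bound that ignores all cancellation, by Cauchy-Schwarz in \<open>n\<close> for each shift \<open>m\<close>. It is
  the better one when \<open>M \<le> sqrt N\<close>.\<close>

lemma shifted_sum_le_mean_square:
  fixes A :: "int \<Rightarrow> complex"
  assumes l: "l \<ge> 2" and "M \<le> N" and C: "C \<ge> 0" "\<And>N. (\<Sum>n=1..N. (norm (A (int n)))\<^sup>2) \<le> C * real N"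
  shows "norm (\<Sum>n=1..N. \<Sum>m=1..M. of_nat (r_squares l n) * A (int (n + m)))
    \<le> sqrt (416 * 9 ^ (l - 2) * C) * (sqrt (real N) ^ l * real M * (1 + ln (1 + 2 * sqrt (real N))))"
proof -
  define r where "r n = real (r_squares l n)" for n
  define L where "L = 1 + ln (1 + 2 * sqrt (real N))"
  have L: "L \<ge> 0" by (simp add: L_def)
  have inner: "(\<Sum>n=1..N. r n * norm (A (int (n + m))))
      \<le> sqrt (416 * 9 ^ (l - 2) * C) * sqrt (real N) ^ l * L"
    if m: "m \<in> {1..M}" for m
  proof -
    have "(\<Sum>n=1..N. (norm (A (int (n + m))))\<^sup>2) = (\<Sum>k=1+m..N+m. (norm (A (int k)))\<^sup>2)"
      by (rule sum.shift_bounds_cl_nat_ivl[symmetric])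
    also have "\<dots> \<le> (\<Sum>k=1..2*N. (norm (A (int k)))\<^sup>2)"
      using m \<open>M \<le> N\<close> by (intro sum_mono2) auto
    also have "\<dots> \<le> C * real (2 * N)" by (rule C)
    finally have A2: "(\<Sum>n=1..N. (norm (A (int (n + m))))\<^sup>2) \<le> C * real (2 * N)" .
    have "(\<Sum>n=1..N. r n * norm (A (int (n + m))))\<^sup>2
        \<le> (\<Sum>n=1..N. (r n)\<^sup>2) * (\<Sum>n=1..N. (norm (A (int (n + m))))\<^sup>2)"
      by (rule Cauchy_Schwarz_ineq_sum)
    also have "\<dots> \<le> (208 * 9 ^ (l - 2) * real N ^ (l - 1) * L\<^sup>2) * (C * real (2 * N))"
      unfolding r_def L_def using l by (intro mult_mono A2 sum_r_squares_power2_le sum_nonneg) auto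
    also have "\<dots> = (416 * 9 ^ (l - 2) * C) * (real N ^ (l - 1) * real N) * L\<^sup>2" by simp
    also have "real N ^ (l - 1) * real N = real N ^ l" using l by (simp flip: power_Suc2)
    finally have "(\<Sum>n=1..N. r n * norm (A (int (n + m))))
        \<le> sqrt ((416 * 9 ^ (l - 2) * C) * real N ^ l * L\<^sup>2)"
      by (rule real_le_rsqrt)
    thus ?thesis using L by (simp add: real_sqrt_mult real_sqrt_power)
  qed
  have "norm (\<Sum>n=1..N. \<Sum>m=1..M. of_nat (r_squares l n) * A (int (n + m)))
     \<le> (\<Sum>n=1..N. \<Sum>m=1..M. r n * norm (A (int (n + m))))"
    by (intro order.trans[OF norm_sum] sum_mono) (simp add: r_def norm_mult)
  also have "\<dots> = (\<Sum>m=1..M. \<Sum>n=1..N. r n * norm (A (int (n + m))))" by (rule sum.swap)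
  also have "\<dots> \<le> (\<Sum>m=1..M. sqrt (416 * 9 ^ (l - 2) * C) * sqrt (real N) ^ l * L)"
    by (intro sum_mono inner)
  finally show ?thesis by (simp add: L_def mult_ac)
qed

text \<open>Here the cancellation in the inner sum, a difference of two partial sums of the coefficients, is
  used for each \<open>n\<close> separately. This is better than the previous bound when \<open>M\<close> exceeds \<open>sqrt N\<close>.\<close>

lemma shifted_sum_le_partial_sums:
  fixes A :: "int \<Rightarrow> complex"
  assumes "M \<le> N" and C: "C \<ge> 0" "\<And>N. norm (\<Sum>n=1..N. A (int n))
      \<le> C * sqrt (real N) * ln (1 + 2 * real N)"
  shows "norm (\<Sum>n=1..N. \<Sum>m=1..M. of_nat (r_squares l n) * A (int (n + m)))
    \<le> (4 * C * 3 ^ l) * (sqrt (real N) ^ l * sqrt (real N) * ln (1 + 4 * real N))"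
proof -
  define S where "S k = (\<Sum>n=1..k. A (int n))" for k
  define Q where "Q = 4 * C * sqrt (real N) * ln (1 + 4 * real N)"
  have S: "norm (S k) \<le> Q / 2" if "k \<le> 2 * N" for k
  proof -
    have k: "real k \<le> 2 * real N" using of_nat_mono[OF that, where ?'a = real] by simp
    hence "sqrt (real k) \<le> sqrt (4 * real N)" by (intro real_sqrt_le_mono) simp
    moreover have "ln (1 + 2 * real k) \<le> ln (1 + 4 * real N)" using k by simp
    ultimately have "C * sqrt (real k) * ln (1 + 2 * real k)
        \<le> C * (2 * sqrt (real N)) * ln (1 + 4 * real N)"
      using C(1) by (intro mult_mono) (auto simp: real_sqrt_mult)
    with C(2)[of k] show ?thesis by (simp add: S_def Q_def)
  qed
  have inner: "norm (\<Sum>m=1..M. A (int (n + m))) \<le> Q" if n: "n \<in> {1..N}" for n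
  proof -
    have "{1..n + M} = {1..n} \<union> {1 + n..M + n}" by auto
    hence "S (n + M) = S n + (\<Sum>k=1+n..M+n. A (int k))"
      unfolding S_def by (subst sum.union_disjoint[symmetric]) auto
    also have "(\<Sum>k=1+n..M+n. A (int k)) = (\<Sum>m=1..M. A (int (n + m)))"
      by (subst sum.shift_bounds_cl_nat_ivl) (simp add: add.commute)
    finally have "(\<Sum>m=1..M. A (int (n + m))) = S (n + M) - S n" by simp
    also have "norm \<dots> \<le> Q / 2 + Q / 2"
      using n \<open>M \<le> N\<close> by (intro order.trans[OF norm_triangle_ineq4] add_mono S) auto
    finally show ?thesis by simp
  qed
  have Q: "Q \<ge> 0" using C(1) by (simp add: Q_def)
  have "norm (\<Sum>n=1..N. \<Sum>m=1..M. of_nat (r_squares l n) * A (int (n + m)))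
     \<le> (\<Sum>n=1..N. norm (of_nat (r_squares l n) * (\<Sum>m=1..M. A (int (n + m)))))"
    unfolding sum_distrib_left[symmetric] by (rule norm_sum)
  also have "\<dots> \<le> (\<Sum>n=1..N. real (r_squares l n) * Q)"
    unfolding norm_mult norm_of_nat by (intro sum_mono mult_left_mono inner) auto
  also have "\<dots> = (\<Sum>n=1..N. real (r_squares l n)) * Q" by (rule sum_distrib_right[symmetric])
  also have "\<dots> \<le> (3 ^ l * sqrt (real N) ^ l) * Q" by (intro mult_right_mono sum_r_squares_le Q)
  finally show ?thesis by (simp add: Q_def mult_ac)
qed

lemma log_le_powr:
  fixes \<delta> :: real
  assumes "\<delta> > 0" "x \<ge> 1"
  shows "1 + ln (1 + 4 * x) \<le> (1 + ln 5 + 1 / \<delta>) * x powr \<delta>"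
proof -
  have "ln (1 + 4 * x) \<le> ln (5 * x)" using assms by simp
  also have "\<dots> = ln 5 + ln x" using assms by (simp add: ln_mult)
  also have "ln x \<le> x powr \<delta> / \<delta>" using assms by (intro ln_powr_bound)
  finally have "1 + ln (1 + 4 * x) \<le> (1 + ln 5) * 1 + x powr \<delta> / \<delta>" by simp
  also have "\<dots> \<le> (1 + ln 5) * x powr \<delta> + x powr \<delta> / \<delta>"
    using assms by (intro add_right_mono mult_left_mono ge_one_powr_ge_zero) auto
  finally show ?thesis by (simp add: algebra_simps)
qed

text \<open>The right side is \<open>X\<^bsup>3/8\<^esup> Y\<^bsup>1/4\<^esup> = (sqrt X)\<^bsup>3/4\<^esup> Y\<^bsup>1/4\<^esup>\<close>, a weighted geometric mean of \<open>sqrt X\<close>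
  and \<open>Y\<close>.\<close>

lemma min_le_geometric_mean:
  fixes X Y :: real
  assumes "X \<ge> 1" "Y \<ge> 1"
  shows "min Y (sqrt X) \<le> X powr (3 / 8) / Y powr (3 / 4) * Y"
proof -
  define p where "p = min Y (sqrt X)"
  have p: "p \<ge> 1" using assms by (simp add: p_def)
  have "p = p powr (3 / 4) * p powr (1 / 4)" using p by (simp flip: powr_add)
  also have "\<dots> \<le> sqrt X powr (3 / 4) * Y powr (1 / 4)"
    using p assms by (intro mult_mono powr_mono2) (auto simp: p_def)
  also have "sqrt X powr (3 / 4) = X powr (3 / 8)"
    using assms by (simp add: powr_powr flip: powr_half_sqrt)
  also have "Y powr (1 / 4) = Y / Y powr (3 / 4)"
  proof -
    have "Y powr (1 / 4) * Y powr (3 / 4) = Y" using assms by (simp flip: powr_add)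
    thus ?thesis using assms by (simp add: field_simps)
  qed
  finally show ?thesis by (simp add: p_def)
qed

lemma shifted_sum_bound:
  fixes A :: "int \<Rightarrow> complex"
  assumes l: "l \<ge> 2" and \<epsilon>: "\<epsilon> > 0"
    and mean_square: "\<exists>C\<ge>0. \<forall>N. (\<Sum>n=1..N. (norm (A (int n)))\<^sup>2) \<le> C * real N"
    and partial_sum: "\<exists>C\<ge>0. \<forall>N. norm (\<Sum>n=1..N. A (int n)) \<le> C * sqrt N * ln (1 + 2 * real N)"
  shows "\<exists>C>0. \<forall>X\<ge>1. \<forall>Y\<ge>1. Y < X powr (1 - \<epsilon>) \<longrightarrow>
          norm (\<Sum>n = 1..nat \<lfloor>X\<rfloor>. \<Sum>m = 1..nat \<lfloor>Y\<rfloor>. of_nat (r_squares l n) * A (int (n + m)))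
            \<le> C * (X powr (3 / 8) / Y powr (3 / 4)) * (X powr (real l / 2) * Y) powr (1 + \<epsilon>)"
proof -
  obtain C1 where C1: "C1 \<ge> 0" "\<And>N. (\<Sum>n=1..N. (norm (A (int n)))\<^sup>2) \<le> C1 * real N"
    using mean_square by blast
  obtain C2 where C2: "C2 \<ge> 0" "\<And>N. norm (\<Sum>n=1..N. A (int n)) \<le> C2 * sqrt N * ln (1 + 2 * real N)"
    using partial_sum by blast
  define D where "D = sqrt (416 * 9 ^ (l - 2) * C1) + 4 * C2 * 3 ^ l + 1"
  have D: "sqrt (416 * 9 ^ (l - 2) * C1) \<le> D" "4 * C2 * 3 ^ l \<le> D" "D > 0"
    using C1(1) C2(1) by (auto simp: D_def intro!: add_nonneg_pos add_nonneg_nonneg)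
  \<comment> \<open>The slack \<open>(X\<^bsup>l/2\<^esup> Y)\<^bsup>\<epsilon>\<^esup> \<ge> X\<^bsup>\<delta>\<^esup>\<close> absorbs the logarithm.\<close>
  define \<delta> where "\<delta> = \<epsilon> * real l / 2"
  have \<delta>: "\<delta> > 0" using \<epsilon> l by (simp add: \<delta>_def)
  define K where "K = 1 + ln 5 + 1 / \<delta>"
  have K: "K > 0" using \<delta> by (auto simp: K_def intro!: add_pos_pos)
  have "norm (\<Sum>n = 1..nat \<lfloor>X\<rfloor>. \<Sum>m = 1..nat \<lfloor>Y\<rfloor>. of_nat (r_squares l n) * A (int (n + m)))
            \<le> (D * K) * (X powr (3 / 8) / Y powr (3 / 4)) * (X powr (real l / 2) * Y) powr (1 + \<epsilon>)"
    (is "norm ?S \<le> _") if X: "X \<ge> 1" and Y: "Y \<ge> 1" and YX: "Y < X powr (1 - \<epsilon>)" for X Y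
  proof -
    have "X powr (1 - \<epsilon>) \<le> X powr 1" using X \<epsilon> by (intro powr_mono) auto
    hence "Y \<le> X" using YX X by simp
    define N where "N = nat \<lfloor>X\<rfloor>"
    define M where "M = nat \<lfloor>Y\<rfloor>"
    have N: "real N \<le> X" "1 \<le> real N" and M: "real M \<le> Y"
    using X Y by (auto simp: N_def M_def of_nat_floor le_nat_floor)
    have MN: "M \<le> N" unfolding N_def M_def using \<open>Y \<le> X\<close> by (intro nat_mono floor_mono)
    define L where "L = 1 + ln (1 + 4 * X)"
    have L: "L \<ge> 0" using X by (simp add: L_def)
    have sqrtN: "sqrt (real N) \<le> sqrt X" using N by simp
    have "sqrt (real N) \<le> real N" using N by (intro real_le_lsqrt) (auto simp: power2_eq_square)
    hence "2 * sqrt (real N) \<le> 4 * X" using N by linarith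
    hence L1: "1 + ln (1 + 2 * sqrt (real N)) \<le> L"
      unfolding L_def by (intro add_left_mono ln_mono) (auto intro: add_pos_nonneg)
    have L2: "ln (1 + 4 * real N) \<le> L" unfolding L_def using N by (intro add_increasing) auto
    define R where "R = X powr (real l / 2)"
    have R: "sqrt X ^ l = R" "R > 0"
      using X by (auto simp: R_def powr_powr powr_realpow[symmetric] simp flip: powr_half_sqrt)
    have RN: "sqrt (real N) ^ l \<le> R"
      unfolding R(1)[symmetric] using sqrtN by (intro power_mono) auto
    have "norm ?S \<le> sqrt (416 * 9 ^ (l - 2) * C1) *
        (sqrt (real N) ^ l * real M * (1 + ln (1 + 2 * sqrt (real N))))"
      unfolding N_def[symmetric] M_def[symmetric] by (rule shifted_sum_le_mean_square[OF l MN C1])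
    also have "\<dots> \<le> D * (R * Y * L)"
      using D RN M L1 R(2) L Y N by (intro mult_mono) auto
    finally have 1: "norm ?S \<le> D * (R * Y * L)" .
    have "norm ?S \<le> (4 * C2 * 3 ^ l) * (sqrt (real N) ^ l * sqrt (real N) * ln (1 + 4 * real N))"
      unfolding N_def[symmetric] M_def[symmetric] by (rule shifted_sum_le_partial_sums[OF MN C2])
    also have "\<dots> \<le> D * (R * sqrt X * L)"
      using D RN sqrtN L2 R(2) L X N by (intro mult_mono) auto
    finally have 2: "norm ?S \<le> D * (R * sqrt X * L)" .
    have "norm ?S \<le> D * (R * min Y (sqrt X) * L)"
      using 1 2 by (cases "Y \<le> sqrt X") (auto simp: min_def)
    also have "\<dots> \<le> D * (R * (X powr (3 / 8) / Y powr (3 / 4) * Y) * (K * X powr \<delta>))"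
      using D R L X Y log_le_powr[OF \<delta> X]
      by (intro mult_mono mult_left_mono min_le_geometric_mean) (auto simp: L_def K_def)
    also have "\<dots> = (D * K) * (X powr (3 / 8) / Y powr (3 / 4)) * (R * Y * X powr \<delta>)" by simp
    also have "\<dots> \<le> (D * K) * (X powr (3 / 8) / Y powr (3 / 4)) * (R * Y) powr (1 + \<epsilon>)"
    proof (intro mult_left_mono)
      have "X powr \<delta> = R powr \<epsilon>" by (simp add: R_def \<delta>_def powr_powr mult.commute)
      also have "\<dots> \<le> (R * Y) powr \<epsilon>" using R(2) Y \<epsilon> by (intro powr_mono2) auto
      finally have "R * Y * X powr \<delta> \<le> R * Y * (R * Y) powr \<epsilon>"
        using R(2) Y by (intro mult_left_mono) auto
      thus "R * Y * X powr \<delta> \<le> (R * Y) powr (1 + \<epsilon>)" using R(2) Y by (simp add: powr_add)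
    qed (use D K in auto)
    finally show ?thesis by (simp add: R_def)
  qed
  thus ?thesis using D K by (intro exI[of _ "D * K"]) auto
qed

lemma saving_factor_less_1:
  fixes X Y :: real
  assumes "X \<ge> 1" "X powr (1 / 2) < Y"
  shows "X powr (3 / 8) / Y powr (3 / 4) < 1"
proof -
  have "X powr (3 / 8) = (X powr (1 / 2)) powr (3 / 4)" by (simp add: powr_powr)
  also have "\<dots> < Y powr (3 / 4)" using assms by (intro powr_less_mono2) auto
  finally show ?thesis using assms by (subst divide_less_eq_1_pos) (auto intro: less_le_trans)
qed

theorem corollary1p2:
  fixes f :: "complex \<Rightarrow> complex" and A :: "int \<Rightarrow> complex" and l :: nat
  assumes form:
      "(\<exists>\<kappa>. hecke_holomorphic_cusp_form \<kappa> f \<and> holomorphic_fourier_coeffs \<kappa> f A) \<or>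
       (\<exists>\<nu>. hecke_maass_cusp_form \<nu> f \<and> maass_fourier_coeffs \<nu> f A)"
    and normalized: "A 1 = 1"
    and l_gt_4: "l > 4"
  shows
    "\<forall>\<epsilon>>0.
       (\<exists>C>0. \<forall>X\<ge>1. \<forall>Y\<ge>1. Y < X powr (1 - \<epsilon>) \<longrightarrow>
          norm (\<Sum>n = 1..nat \<lfloor>X\<rfloor>. \<Sum>m = 1..nat \<lfloor>Y\<rfloor>.
                  of_nat (r_squares l n) * A (int (n + m)))
            \<le> C * (X powr (3 / 8) / Y powr (3 / 4)) * (X powr (real l / 2) * Y) powr (1 + \<epsilon>)) \<and>
       (\<forall>X\<ge>1. \<forall>Y\<ge>1. X powr (1 / 2) < Y \<and> Y < X powr (1 - \<epsilon>) \<longrightarrow>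
          X powr (3 / 8) / Y powr (3 / 4) < (1::real))"
proof -
  obtain h W I where "whittaker_expansion h A W I"
    using form holomorphic_whittaker_expansion maass_whittaker_expansion
    unfolding hecke_holomorphic_cusp_form_def hecke_maass_cusp_form_def by blast
  then interpret whittaker_expansion h A W I .
  have "l \<ge> 2" using l_gt_4 by simp
  thus ?thesis
    using shifted_sum_bound[OF _ _ mean_square partial_sum] saving_factor_less_1 by blast
qed

end
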